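(* Let $q\ge2$ be an integer and let $G$ be a closed non-compact subgroup of $\mathrm{Aut}(\mathcal{T}_{q+1})$ acting transitively on the vertices and on the boundary $\partial\mathcal{T}_{q+1}$ of the $(q+1)$-regular tree $\mathcal{T}_{q+1}$. Let $\psi$ be a function conditionally of negative type on $G$ which is pure in $\mathrm{CL}(G)$ and vanishes on the stabiliser $G_{x_0}$ of some vertex $x_0$. Then one of the following holds: 1. $\psi$ is bounded on $G$, and then it is of the form $$\psi(g)=\|\xi\|^2-\langle\pi_\psi(g)\xi,\xi\rangle,$$ where $\pi_\psi$ is the irreducible unitary representation associated with $\psi$ via the GNS construction, and $\xi$ is a $\pi_\psi(G_{x_0})$-fixed vector (which is unique up to scalar multiplication). 2. $\psi$ is unbounded, and then it is of the form $$\psi(g)=C\left(|g|+\frac{2q}{q^2-1}\left(q^{-|g|}-1\right)\right),$$ where $|g|:=d(gx_0,x_0)$ and $C$ is a positive constant.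
   Context: $\mathrm{Aut}(\mathcal{T}_{q+1})$ carries the topology of pointwise convergence on vertices; $\partial\mathcal{T}_{q+1}$ is the space of ends; $d$ is the graph distance. A continuous function $\psi:G\to\mathbb{R}$ is conditionally of negative type if $\psi(e)=0$, $\psi(g^{-1})=\psi(g)$, and $\sum_{i,j}\alpha_i\alpha_j\psi(g_i^{-1}g_j)\le0$ for all $g_1,\dots,g_n\in G$ and real $\alpha_i$ with $\sum_i\alpha_i=0$. $\mathrm{CL}(G)$ is the convex cone of these functions; a (non-zero) $\psi$ is pure if it lies on an extremal ray of $\mathrm{CL}(G)$. The GNS construction associates to $\psi\in\mathrm{CL}(G)$ a triple $(\pi_\psi,\mathcal{H}_\psi,b_\psi)$, unique up to isometric isomorphism, where $\pi_\psi$ is a continuous unitary (orthogonal, $\mathcal{H}_\psi$ being real) representation of $G$ on $\mathcal{H}_\psi$ and $b_\psi:G\to\mathcal{H}_\psi$ is a continuous cocycle ($b_\psi(gh)=\pi_\psi(g)b_\psi(h)+b_\psi(g)$) whose image spans a dense subspace, with $\psi(g)=\|b_\psi(g)\|^2$ for all $g\in G$. *)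

theory Defs
  imports "HOL-Analysis.Analysis" "HOL-Algebra.Group"
begin

section \<open>Regular trees, given by an adjacency relation on a vertex type\<close>

definition acyclic_graph :: "('v \<Rightarrow> 'v \<Rightarrow> bool) \<Rightarrow> bool" where
  "acyclic_graph adj \<longleftrightarrow>
     \<not> (\<exists>xs. 3 \<le> length xs \<and> distinct xs \<and> successively adj xs \<and> adj (last xs) (hd xs))"

definition is_tree :: "('v \<Rightarrow> 'v \<Rightarrow> bool) \<Rightarrow> bool" where
  "is_tree adj \<longleftrightarrow> symp adj \<and> irreflp adj \<and> (\<forall>x y. adj\<^sup>*\<^sup>* x y) \<and> acyclic_graph adj"

text \<open>A cardinality of 0 could also mean an infinite neighbourhood; this is only used
  with \<open>k \<ge> 3\<close>.\<close>

definition regular_tree :: "nat \<Rightarrow> ('v \<Rightarrow> 'v \<Rightarrow> bool) \<Rightarrow> bool" where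
  "regular_tree k adj \<longleftrightarrow> is_tree adj \<and> (\<forall>x. card {y. adj x y} = k)"

definition graph_dist :: "('v \<Rightarrow> 'v \<Rightarrow> bool) \<Rightarrow> 'v \<Rightarrow> 'v \<Rightarrow> nat" where
  "graph_dist adj x y = (LEAST n. (adj ^^ n) x y)"

text \<open>The ends of a tree: infinite injective paths, two of them being identified when they
  coincide, up to a shift of the parametrisation, from some point on.\<close>

definition rays :: "('v \<Rightarrow> 'v \<Rightarrow> bool) \<Rightarrow> (nat \<Rightarrow> 'v) set" where
  "rays adj = {r. inj r \<and> (\<forall>n. adj (r n) (r (Suc n)))}"

definition cofinal_rel :: "('v \<Rightarrow> 'v \<Rightarrow> bool) \<Rightarrow> ((nat \<Rightarrow> 'v) \<times> (nat \<Rightarrow> 'v)) set" where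
  "cofinal_rel adj =
     {(r, s). r \<in> rays adj \<and> s \<in> rays adj \<and> (\<exists>m n. \<forall>k. r (m + k) = s (n + k))}"

definition tree_boundary :: "('v \<Rightarrow> 'v \<Rightarrow> bool) \<Rightarrow> (nat \<Rightarrow> 'v) set set" where
  "tree_boundary adj = rays adj // cofinal_rel adj"


section \<open>The automorphism group and its topology\<close>

definition Aut :: "('v \<Rightarrow> 'v \<Rightarrow> bool) \<Rightarrow> ('v \<Rightarrow> 'v) monoid" where
  "Aut adj = \<lparr>carrier = {f. bij f \<and> (\<forall>x y. adj (f x) (f y) \<longleftrightarrow> adj x y)},
              monoid.mult = (\<circ>), one = id\<rparr>"

text \<open>Pointwise convergence on (discrete) vertices.\<close>

definition Aut_topology :: "('v \<Rightarrow> 'v \<Rightarrow> bool) \<Rightarrow> ('v \<Rightarrow> 'v) topology" where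
  "Aut_topology adj =
     subtopology (product_topology (\<lambda>_. discrete_topology UNIV) UNIV) (carrier (Aut adj))"

definition vertex_transitive :: "('v \<Rightarrow> 'v) set \<Rightarrow> bool" where
  "vertex_transitive G \<longleftrightarrow> (\<forall>x y. \<exists>g\<in>G. g x = y)"

definition boundary_transitive :: "('v \<Rightarrow> 'v \<Rightarrow> bool) \<Rightarrow> ('v \<Rightarrow> 'v) set \<Rightarrow> bool" where
  "boundary_transitive adj G \<longleftrightarrow>
     (\<forall>\<omega>\<in>tree_boundary adj. \<forall>\<omega>'\<in>tree_boundary adj. \<exists>g\<in>G. (\<lambda>r. g \<circ> r) ` \<omega> = \<omega>')"

definition vertex_stabiliser :: "('v \<Rightarrow> 'v) set \<Rightarrow> 'v \<Rightarrow> ('v \<Rightarrow> 'v) set" where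
  "vertex_stabiliser G x = {g \<in> G. g x = x}"


section \<open>Functions conditionally of negative type\<close>

text \<open>In this and the next section a topological group is a group \<open>G\<close> together with a
  topology \<open>T\<close> on its carrier. Functions on the group are total functions on the element
  type whose values outside the carrier are irrelevant.\<close>

definition CL :: "('g, 'm) monoid_scheme \<Rightarrow> 'g topology \<Rightarrow> ('g \<Rightarrow> real) set" where
  "CL G T = {\<psi>. continuous_map T euclideanreal \<psi> \<and> \<psi> \<one>\<^bsub>G\<^esub> = 0 \<and>
     (\<forall>g\<in>carrier G. \<psi> (inv\<^bsub>G\<^esub> g) = \<psi> g) \<and>
     (\<forall>(n::nat) (g :: nat \<Rightarrow> 'g) (\<alpha> :: nat \<Rightarrow> real).
        (\<forall>i<n. g i \<in> carrier G) \<longrightarrow> (\<Sum>i<n. \<alpha> i) = 0 \<longrightarrow>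
        (\<Sum>i<n. \<Sum>j<n. \<alpha> i * \<alpha> j * \<psi> (inv\<^bsub>G\<^esub> (g i) \<otimes>\<^bsub>G\<^esub> g j)) \<le> 0)}"

text \<open>\<open>\<psi>\<close> spans an extremal ray of the cone. By the symmetry between the two summands, the
  second one is a multiple of \<open>\<psi>\<close> as well.\<close>

definition pure_in_CL :: "('g, 'm) monoid_scheme \<Rightarrow> 'g topology \<Rightarrow> ('g \<Rightarrow> real) \<Rightarrow> bool" where
  "pure_in_CL G T \<psi> \<longleftrightarrow> \<psi> \<in> CL G T \<and> (\<exists>g\<in>carrier G. \<psi> g \<noteq> 0) \<and>
     (\<forall>\<psi>\<^sub>1\<in>CL G T. \<forall>\<psi>\<^sub>2\<in>CL G T. (\<forall>g\<in>carrier G. \<psi> g = \<psi>\<^sub>1 g + \<psi>\<^sub>2 g) \<longrightarrow>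
        (\<exists>c\<ge>0. \<forall>g\<in>carrier G. \<psi>\<^sub>1 g = c * \<psi> g))"


section \<open>Representations, cocycles and GNS triples\<close>

text \<open>A real Hilbert space is a closed subspace \<open>H\<close> of a type that is itself a real Hilbert
  space (possibly all of it). The values of \<open>\<pi> g\<close> outside \<open>H\<close> are irrelevant.\<close>

definition unitary_rep ::
  "('g, 'm) monoid_scheme \<Rightarrow> 'g topology \<Rightarrow> 'h::{real_inner, complete_space} set \<Rightarrow>
   ('g \<Rightarrow> 'h \<Rightarrow> 'h) \<Rightarrow> bool" where
  "unitary_rep G T H \<pi> \<longleftrightarrow> subspace H \<and> closed H \<and>
     (\<forall>g\<in>carrier G. \<pi> g ` H = H \<and>
        (\<forall>v\<in>H. \<forall>w\<in>H. \<pi> g (v + w) = \<pi> g v + \<pi> g w) \<and>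
        (\<forall>c. \<forall>v\<in>H. \<pi> g (c *\<^sub>R v) = c *\<^sub>R \<pi> g v) \<and>
        (\<forall>v\<in>H. \<forall>w\<in>H. \<pi> g v \<bullet> \<pi> g w = v \<bullet> w)) \<and>
     (\<forall>v\<in>H. \<pi> \<one>\<^bsub>G\<^esub> v = v) \<and>
     (\<forall>g\<in>carrier G. \<forall>h\<in>carrier G. \<forall>v\<in>H. \<pi> (g \<otimes>\<^bsub>G\<^esub> h) v = \<pi> g (\<pi> h v)) \<and>
     (\<forall>v\<in>H. continuous_map T euclidean (\<lambda>g. \<pi> g v))"

definition irreducible_rep ::
  "('g, 'm) monoid_scheme \<Rightarrow> 'h::{real_inner, complete_space} set \<Rightarrow>
   ('g \<Rightarrow> 'h \<Rightarrow> 'h) \<Rightarrow> bool" where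
  "irreducible_rep G H \<pi> \<longleftrightarrow> H \<noteq> {0} \<and>
     (\<forall>W. subspace W \<longrightarrow> closed W \<longrightarrow> W \<subseteq> H \<longrightarrow> (\<forall>g\<in>carrier G. \<pi> g ` W \<subseteq> W) \<longrightarrow>
        W = {0} \<or> W = H)"

definition cocycle ::
  "('g, 'm) monoid_scheme \<Rightarrow> 'g topology \<Rightarrow> 'h::{real_inner, complete_space} set \<Rightarrow>
   ('g \<Rightarrow> 'h \<Rightarrow> 'h) \<Rightarrow> ('g \<Rightarrow> 'h) \<Rightarrow> bool" where
  "cocycle G T H \<pi> b \<longleftrightarrow> b ` carrier G \<subseteq> H \<and> continuous_map T euclidean b \<and>
     (\<forall>g\<in>carrier G. \<forall>h\<in>carrier G. b (g \<otimes>\<^bsub>G\<^esub> h) = \<pi> g (b h) + b g)"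

definition GNS_triple ::
  "('g, 'm) monoid_scheme \<Rightarrow> 'g topology \<Rightarrow> ('g \<Rightarrow> real) \<Rightarrow>
   'h::{real_inner, complete_space} set \<Rightarrow> ('g \<Rightarrow> 'h \<Rightarrow> 'h) \<Rightarrow> ('g \<Rightarrow> 'h) \<Rightarrow> bool" where
  "GNS_triple G T \<psi> H \<pi> b \<longleftrightarrow> unitary_rep G T H \<pi> \<and> cocycle G T H \<pi> b \<and>
     closure (span (b ` carrier G)) = H \<and> (\<forall>g\<in>carrier G. \<psi> g = (norm (b g))\<^sup>2)"

end

theory Submission
  imports Defs "HOL-Library.Diagonal_Subsequence" "HOL-Real_Asymp.Real_Asymp"
begin

text \<open>The proof works with the radial profile of \<open>\<psi>\<close> and with the averaging
operator \<open>M\<close> over the \<open>q + 1\<close> neighbours of a vertex.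

Let \<open>K\<close> be the stabiliser of \<open>x\<^sub>0\<close>. Transitivity on the boundary forces \<open>K\<close> to be
transitive on every sphere around \<open>x\<^sub>0\<close> (\<open>sphere_transitive\<close>): the boundary is the union of
countably many translates of a \<open>K\<close>-orbit, these are closed, so by Baire's argument every
\<open>K\<close>-orbit of ends is open, and a compactness argument together with vertex transitivity turns
this into transitivity on the forks at all vertices. As \<open>\<psi>\<close> vanishes on \<open>K\<close> it is
bi-invariant under \<open>K\<close>, hence \<open>\<psi> g = \<phi> \<bar>g\<bar>\<close> for a function \<open>\<phi>\<close> on the naturals.

The kernel \<open>\<phi> (d x y)\<close> is of negative type, so minus the form that it defines on signed point
masses of total mass 0 is a semi-inner product. The operator \<open>M\<close> is symmetric for it, because
radial kernels commute with \<open>M\<close>. A symmetric operator whose powers grow polynomially on each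
vector is a contraction, and the growth is polynomial because \<open>\<phi> n \<le> n\<^sup>2 \<phi> 1\<close>. Therefore
\<open>(1 \<plusminus> M) / 2\<close> are both positive, and they split \<open>\<psi>\<close> into a sum of two members of the cone.
Purity makes \<open>M\<close> a scalar \<open>l\<close>, that is, \<open>M \<phi> = l \<phi> + \<phi> 1\<close>
(\<open>pure_radial_eigenfunction\<close>).

If \<open>l = 1\<close>, this recurrence is the one of a harmonic cocycle and its solution is the unbounded
function of the theorem (\<open>harmonic_kernel_formula\<close>).

If \<open>l \<noteq> 1\<close>, the orbit map \<open>B (g x\<^sub>0) = b g\<close> of the affine action satisfies
\<open>M B = l B + \<delta>\<close> with a constant vector \<open>\<delta>\<close>. Its Laplacian \<open>M B - B\<close> is then equivariant
for the linear action, takes the value \<open>\<delta>\<close> at \<open>x\<^sub>0\<close>, and differs from \<open>(l - 1) B\<close> by the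
constant \<open>\<delta>\<close>; so \<open>b\<close> is the coboundary of \<open>\<delta> / (l - 1)\<close>. Boundedness is the kernel
version of this observation (\<open>eigen_kernel_bounded\<close>). A \<open>K\<close>-fixed vector \<open>\<eta>\<close> orthogonal to
\<open>\<delta>\<close> gives a radial eigenfunction \<open>\<eta> \<bullet> (M B - B)\<close> of \<open>M\<close> vanishing at \<open>x\<^sub>0\<close>, which is
0; hence \<open>\<eta> = 0\<close>. So the fixed vectors form the line of \<open>\<delta>\<close>, and irreducibility follows by
projecting \<open>\<delta>\<close> to an invariant subspace.\<close>

section \<open>Distance and parents in a regular tree\<close>

lemma rtranclp_imp_distinct_path:
  assumes "r\<^sup>*\<^sup>* a b"
  shows "\<exists>xs. xs \<noteq> [] \<and> hd xs = a \<and> last xs = b \<and> distinct xs \<and> successively r xs \<and>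
           (\<forall>z\<in>set xs. r\<^sup>*\<^sup>* a z)"
  using assms
proof (induction rule: rtranclp_induct)
  case base
  show ?case by (rule exI[of _ "[a]"]) auto
next
  case (step b c)
  then obtain xs where xs: "xs \<noteq> []" "hd xs = a" "last xs = b" "distinct xs" "successively r xs"
    "\<forall>z\<in>set xs. r\<^sup>*\<^sup>* a z" by blast
  show ?case
  proof (cases "c \<in> set xs")
    case False
    have "r\<^sup>*\<^sup>* a c" using step by simp
    then show ?thesis using xs False step
      by (intro exI[of _ "xs @ [c]"]) (auto simp: successively_append_iff)
  next
    case True
    then obtain ys zs where yz: "xs = ys @ c # zs" by (meson split_list)
    have "successively r ((ys @ [c]) @ zs)" using xs(5) yz by simp
    then have "successively r (ys @ [c])" unfolding successively_append_iff by blast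
    then show ?thesis using xs yz
      by (intro exI[of _ "ys @ [c]"]) (cases ys; auto)
  qed
qed

locale regular_tree_graph =
  fixes adj :: "'v \<Rightarrow> 'v \<Rightarrow> bool" and q :: nat
  assumes q2: "q \<ge> 2" and reg: "regular_tree (q + 1) adj"
begin

abbreviation d :: "'v \<Rightarrow> 'v \<Rightarrow> nat" where "d \<equiv> graph_dist adj"

definition nbrs :: "'v \<Rightarrow> 'v set" where "nbrs x = {y. adj x y}"

lemma adj_sym: "adj x y \<longleftrightarrow> adj y x"
  using reg unfolding regular_tree_def is_tree_def symp_def by blast

lemma adj_irrefl: "\<not> adj x x"
  using reg unfolding regular_tree_def is_tree_def irreflp_def by blast

lemma connected: "adj\<^sup>*\<^sup>* x y"
  using reg unfolding regular_tree_def is_tree_def by blast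

lemma acyclic: "acyclic_graph adj"
  using reg unfolding regular_tree_def is_tree_def by blast

lemma card_nbrs: "card (nbrs x) = q + 1"
  using reg unfolding regular_tree_def nbrs_def by blast

lemma finite_nbrs: "finite (nbrs x)"
  using card_nbrs[of x] by (metis add_is_0 card.infinite zero_neq_one)

lemma dist_walk: "(adj ^^ d x y) x y"
  unfolding graph_dist_def using connected[of x y] rtranclp_power[of adj x y]
  by (metis LeastI_ex)

lemma dist_le: "(adj ^^ n) x y \<Longrightarrow> d x y \<le> n"
  unfolding graph_dist_def by (rule Least_le)

lemma dist_0 [simp]: "d x y = 0 \<longleftrightarrow> x = y"
proof
  assume "d x y = 0" then show "x = y" using dist_walk[of x y] by simp
next
  assume "x = y" then show "d x y = 0" using dist_le[of 0 x y] by simp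
qed

lemma dist_self [simp]: "d x x = 0"
  by simp

lemma walk_sym: "(adj ^^ n) x y \<Longrightarrow> (adj ^^ n) y x"
proof (induction n arbitrary: y)
  case (Suc n)
  then obtain z where "(adj ^^ n) x z" "adj z y" by auto
  then show ?case using Suc.IH[of z] adj_sym relpowp_Suc_I2[of adj y z n x] by blast
qed auto

lemma dist_sym: "d x y = d y x"
  by (meson dist_le dist_walk walk_sym order_antisym)

lemma dist_triangle: "d x z \<le> d x y + d y z"
proof (rule dist_le)
  show "(adj ^^ (d x y + d y z)) x z"
    unfolding relpowp_add using dist_walk by blast
qed

lemma dist_adj: "adj x y \<Longrightarrow> d x y = 1"
proof -
  assume a: "adj x y"
  then have "d x y \<le> 1" by (intro dist_le) auto
  moreover have "d x y \<noteq> 0" using a adj_irrefl by auto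
  ultimately show ?thesis by linarith
qed

lemma dist_1: "d x y = 1 \<longleftrightarrow> adj x y"
  using dist_adj dist_walk[of x y] by auto

lemma dist_Suc_obtain:
  assumes "d x y = Suc n" obtains z where "adj y z" "d x z = n"
proof -
  have "(adj ^^ Suc n) x y" using dist_walk[of x y] assms by simp
  then obtain z where z: "(adj ^^ n) x z" "adj z y" by auto
  then have "d x z \<le> n" by (intro dist_le)
  moreover have "Suc n \<le> d x z + 1" using dist_triangle[of x y z] assms dist_adj[OF z(2)] by simp
  ultimately show thesis using that[of z] z adj_sym by auto
qed

text \<open>Geodesics from \<open>x\<close> to two neighbours of \<open>y\<close> that are not farther from \<open>x\<close> than
  \<open>y\<close> avoid \<open>y\<close>. If the neighbours were different, joining them through \<open>x\<close> and adding
  \<open>y\<close> would give a cycle. This is the only use of acyclicity; the rest of the tree geometry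
  is derived from distances.\<close>

lemma unique_near_neighbour:
  assumes "adj y y1" "adj y y2" "d x y1 \<le> d x y" "d x y2 \<le> d x y"
  shows "y1 = y2"
proof (rule ccontr)
  assume ne: "y1 \<noteq> y2"
  define r where "r u v \<longleftrightarrow> adj u v \<and> u \<noteq> y \<and> v \<noteq> y" for u v
  have reach: "r\<^sup>*\<^sup>* x z" if "z \<noteq> y" "d x z \<le> d x y" for z
    using that
  proof (induction "d x z" arbitrary: z)
    case 0
    then show ?case by simp
  next
    case (Suc n)
    obtain z' where z': "adj z z'" "d x z' = n" using dist_Suc_obtain[of x z n] Suc by auto
    then have "z' \<noteq> y" using Suc by auto
    then have "r\<^sup>*\<^sup>* x z'" using Suc z' by auto
    moreover have "r z' z" unfolding r_def using z' adj_sym Suc.prems \<open>z' \<noteq> y\<close> by auto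
    ultimately show ?case by simp
  qed
  have sy: "symp r" unfolding symp_def r_def using adj_sym by auto
  have y12: "y1 \<noteq> y" "y2 \<noteq> y" using assms adj_irrefl by auto
  have "r\<^sup>*\<^sup>* x y1" "r\<^sup>*\<^sup>* x y2" using reach assms y12 by auto
  then have "r\<^sup>*\<^sup>* y1 y2" using sy by (meson rtranclp_trans symp_rtranclp sympD)
  from rtranclp_imp_distinct_path[OF this] obtain xs where
    xs: "xs \<noteq> []" "hd xs = y1" "last xs = y2" "distinct xs" "successively r xs"
       "\<forall>z\<in>set xs. r\<^sup>*\<^sup>* y1 z" by blast
  have avoid: "z \<noteq> y" if "r\<^sup>*\<^sup>* y1 z" for z
    using that by (induction rule: rtranclp_induct) (use y12 in \<open>auto simp: r_def\<close>)
  have len: "length xs \<ge> 2"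
  proof (rule ccontr)
    assume "\<not> length xs \<ge> 2"
    moreover have "length xs \<noteq> 0" using xs(1) by simp
    ultimately have "length xs = 1" by linarith
    then obtain a where "xs = [a]" by (auto simp: length_Suc_conv)
    then show False using xs ne by auto
  qed
  have suc: "successively adj xs"
    by (rule successively_mono[OF xs(5)]) (auto simp: r_def)
  have "successively adj (y # xs)" using suc xs(1,2) assms(1) by (cases xs) auto
  moreover have "distinct (y # xs)" using xs avoid by auto
  moreover have "adj (last (y # xs)) (hd (y # xs))" using xs assms adj_sym by auto
  moreover have "3 \<le> length (y # xs)" using len by simp
  ultimately show False using acyclic unfolding acyclic_graph_def by blast
qed

definition parent :: "'v \<Rightarrow> 'v \<Rightarrow> 'v" where
  "parent x y = (SOME p. adj y p \<and> d x y = Suc (d x p))"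

lemma parent:
  assumes "y \<noteq> x" shows "adj y (parent x y)" "d x y = Suc (d x (parent x y))"
proof -
  have "d x y \<noteq> 0" using assms by auto
  then obtain n where n: "d x y = Suc n" using not0_implies_Suc by blast
  then obtain z where "adj y z" "d x z = n" using dist_Suc_obtain by blast
  then have "\<exists>p. adj y p \<and> d x y = Suc (d x p)" using n by auto
  from someI_ex[OF this] show "adj y (parent x y)" "d x y = Suc (d x (parent x y))"
    unfolding parent_def by auto
qed

lemma parent_unique:
  assumes "adj y z" "d x z \<le> d x y" shows "z = parent x y"
proof -
  have "y \<noteq> x" using assms adj_irrefl by auto
  then show ?thesis using unique_near_neighbour[of y z "parent x y" x] parent[of y x] assms by auto
qed

lemma forward_neighbour:
  assumes "adj y z" "z \<noteq> parent x y" shows "d x z = Suc (d x y)"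
proof -
  have "\<not> d x z \<le> d x y" using assms parent_unique by blast
  moreover have "d x z \<le> d x y + 1" using dist_triangle[of x z y] dist_adj[OF assms(1)] by simp
  ultimately show ?thesis by simp
qed

lemma forward_neighbour_exists: "\<exists>z. adj y z \<and> d x z = Suc (d x y)"
proof -
  have "card (nbrs y - {parent x y}) \<ge> 1"
    using card_nbrs[of y] q2 finite_nbrs[of y] by (simp add: card_Diff_singleton_if)
  then have "nbrs y - {parent x y} \<noteq> {}" using card.empty by fastforce
  then obtain z where "z \<in> nbrs y" "z \<noteq> parent x y" by blast
  then show ?thesis using forward_neighbour unfolding nbrs_def by auto
qed

text \<open>Uniqueness of the point of a geodesic at a prescribed position: walking back from
  \<open>w\<close>, every step goes to the parent.\<close>

lemma between_unique:
  assumes "d u z + d z w = d u w" "d u z' = d u z" "d z' w = d z w"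
  shows "z = z'"
  using assms
proof (induction "d z w" arbitrary: w)
  case 0
  then show ?case by auto
next
  case (Suc k)
  have step: "d t (parent u w) = k" if t: "d u t + d t w = d u w" "d t w = Suc k" for t
  proof -
    obtain w' where w': "adj w w'" "d t w' = k" using dist_Suc_obtain t(2) by metis
    have "d u w' \<le> d u w" using dist_triangle[of u w' t] w' t by simp
    then show ?thesis using parent_unique w' by blast
  qed
  have "w \<noteq> u"
  proof
    assume "w = u"
    then have "d u w = 0" by simp
    then show False using Suc.prems(1) Suc.hyps(2) by linarith
  qed
  then have "d u w = Suc (d u (parent u w))" using parent by blast
  then have pd: "d u w = Suc (d u (parent u w))" .
  have 1: "d z (parent u w) = k" using step[of z] Suc.prems(1) Suc.hyps(2) by metis
  have 2: "d z' (parent u w) = k" using step[of z'] Suc.prems Suc.hyps(2) by metis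
  have 3: "d u z + d z (parent u w) = d u (parent u w)"
    using 1 pd Suc.prems(1) Suc.hyps(2) by linarith
  have 4: "d z' (parent u w) = d z (parent u w)" using 1 2 by metis
  show ?case by (rule Suc.hyps(1)[OF 1[symmetric] 3 Suc.prems(2) 4])
qed

section \<open>Averages over neighbours\<close>

definition nbr_avg :: "('v \<Rightarrow> 'a::real_vector) \<Rightarrow> 'v \<Rightarrow> 'a" where
  "nbr_avg f x = (1 / (real q + 1)) *\<^sub>R (\<Sum>y\<in>nbrs x. f y)"

text \<open>The action of the neighbour average on functions of the distance to a base vertex, as
  an operator on their profiles.\<close>

definition radial_avg :: "(nat \<Rightarrow> real) \<Rightarrow> nat \<Rightarrow> real" where
  "radial_avg \<phi> n = (if n = 0 then \<phi> 1 else (real q * \<phi> (n + 1) + \<phi> (n - 1)) / (real q + 1))"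

text \<open>One neighbour is the parent of \<open>y\<close>, the other \<open>q\<close> are one step farther away.\<close>

lemma nbr_avg_radial: "nbr_avg (\<lambda>z. \<phi> (d x z)) y = radial_avg \<phi> (d x y)"
proof (cases "y = x")
  case True
  have "(\<Sum>z\<in>nbrs y. \<phi> (d x z)) = (\<Sum>z\<in>nbrs y. \<phi> 1)"
    by (rule sum.cong) (use True dist_adj in \<open>auto simp: nbrs_def\<close>)
  then show ?thesis using True by (simp add: nbr_avg_def radial_avg_def card_nbrs add.commute)
next
  case False
  let ?p = "parent x y"
  have p: "?p \<in> nbrs y" "d x y = Suc (d x ?p)" using parent[OF False] by (auto simp: nbrs_def)
  have "(\<Sum>z\<in>nbrs y. \<phi> (d x z)) = \<phi> (d x ?p) + (\<Sum>z\<in>nbrs y - {?p}. \<phi> (d x z))"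
    using p(1) finite_nbrs by (simp add: sum.remove)
  also have "(\<Sum>z\<in>nbrs y - {?p}. \<phi> (d x z)) = (\<Sum>z\<in>nbrs y - {?p}. \<phi> (d x y + 1))"
    by (rule sum.cong) (use forward_neighbour in \<open>auto simp: nbrs_def\<close>)
  also have "\<dots> = real q * \<phi> (d x y + 1)"
    using p(1) finite_nbrs card_nbrs[of y] by simp
  finally show ?thesis using p(2) by (simp add: nbr_avg_def radial_avg_def)
qed

lemma nbr_avg_const: "nbr_avg (\<lambda>_. c) x = c"
proof -
  have "nbr_avg (\<lambda>_. c) x = (1 / (real q + 1)) *\<^sub>R ((real q + 1) *\<^sub>R c)"
    by (simp add: nbr_avg_def sum_constant_scaleR card_nbrs add.commute)
  then show ?thesis by simp
qed

lemma nbr_avg_add: "nbr_avg (\<lambda>y. f y + g y) x = nbr_avg f x + nbr_avg g x"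
  by (simp add: nbr_avg_def sum.distrib scaleR_add_right)

lemma nbr_avg_diff: "nbr_avg (\<lambda>y. f y - g y) x = nbr_avg f x - nbr_avg g x"
  by (simp add: nbr_avg_def sum_subtractf scaleR_diff_right)

lemma nbr_avg_scaleR: "nbr_avg (\<lambda>y. c *\<^sub>R f y) x = c *\<^sub>R nbr_avg f x"
  by (simp add: nbr_avg_def scaleR_sum_right mult.commute)

lemma nbr_avg_inner: "nbr_avg f x \<bullet> v = nbr_avg (\<lambda>y. f y \<bullet> v) x"
  by (simp add: nbr_avg_def inner_sum_left)

section \<open>Geodesic rays\<close>

text \<open>Every end has exactly one representative of this kind, so these rays are a model of the
  boundary in which a cone of ends is given by one vertex of the ray.\<close>

definition ray_from :: "'v \<Rightarrow> (nat \<Rightarrow> 'v) \<Rightarrow> bool" where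
  "ray_from x r \<longleftrightarrow> (\<forall>i. d x (r i) = i \<and> adj (r i) (r (Suc i)))"

lemma ray_from_adj: "ray_from x r \<Longrightarrow> adj (r i) (r (Suc i))"
  by (simp add: ray_from_def)

lemma ray_from_dist: "ray_from x r \<Longrightarrow> d x (r i) = i"
  by (simp add: ray_from_def)

lemma ray_from_inj: "ray_from x r \<Longrightarrow> r i = r j \<longleftrightarrow> i = j"
  using ray_from_dist by metis

lemma ray_from_in_rays: "ray_from x r \<Longrightarrow> r \<in> rays adj"
  unfolding rays_def using ray_from_inj ray_from_adj by (auto simp: inj_def)

lemma ray_from_parent: "ray_from x r \<Longrightarrow> parent x (r (Suc i)) = r i"
  using parent_unique[of "r (Suc i)" "r i" x] ray_from_adj[of x r i] adj_sym
  by (auto simp: ray_from_dist)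

lemma rays_agree_below:
  assumes "ray_from x r" "ray_from x s" "r n = s n" "i \<le> n"
  shows "r i = s i"
  using assms(4)
proof (induction rule: inc_induct)
  case base
  then show ?case using assms by simp
next
  case (step i)
  then show ?case using ray_from_parent[OF assms(1), of i] ray_from_parent[OF assms(2), of i] by simp
qed

text \<open>Once a path moves away from \<open>x\<close> it can only return through a parent, which is the
  vertex it comes from.\<close>

lemma nonbacktracking_ray:
  assumes adjs: "\<And>i. adj (s i) (s (Suc i))" and nb: "\<And>i. N \<le> Suc i \<Longrightarrow> s (Suc (Suc i)) \<noteq> s i"
    and init: "\<And>i. i \<le> N \<Longrightarrow> d x (s i) = i" and "N \<ge> 1"
  shows "ray_from x s"
proof -
  have "d x (s i) = i" for i
  proof (induction i rule: less_induct)
    case (less i)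
    show ?case
    proof (cases "i \<le> N")
      case True then show ?thesis by (rule init)
    next
      case False
      define j where "j = i - 2"
      have j: "i = Suc (Suc j)" using False \<open>N \<ge> 1\<close> by (simp add: j_def)
      have "d x (s j) = j" "d x (s (Suc j)) = Suc j" using less j by auto
      then have "s j = parent x (s (Suc j))"
        using parent_unique[of "s (Suc j)" "s j" x] adjs[of j] adj_sym by auto
      then have "s i \<noteq> parent x (s (Suc j))" using nb[of j] False j by auto
      then show ?thesis using forward_neighbour[of "s (Suc j)" "s i" x] adjs[of "Suc j"] j
          \<open>d x (s (Suc j)) = Suc j\<close> by auto
    qed
  qed
  then show ?thesis using adjs by (simp add: ray_from_def)
qed

lemma geodesic_segment: "\<exists>p. p (d x w) = w \<and> (\<forall>i\<le>d x w. d x (p i) = i) \<and> (\<forall>i<d x w. adj (p i) (p (Suc i)))"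
proof (induction "d x w" arbitrary: w)
  case 0
  then show ?case by (intro exI[of _ "\<lambda>_. w"]) auto
next
  case (Suc n)
  obtain z where z: "adj w z" "d x z = n" using Suc.hyps(2) dist_Suc_obtain by metis
  obtain p where p: "p n = z" "\<forall>i\<le>n. d x (p i) = i" "\<forall>i<n. adj (p i) (p (Suc i))"
    using Suc.hyps(1)[of z] z by auto
  show ?case
    by (rule exI[of _ "p(Suc n := w)"])
       (use p z Suc.hyps(2)[symmetric] adj_sym in \<open>auto simp: le_Suc_eq less_Suc_eq\<close>)
qed

lemma ray_through: "\<exists>r. ray_from x r \<and> r (d x w) = w"
proof -
  define n where "n = d x w"
  obtain p where p: "p n = w" "\<forall>i\<le>n. d x (p i) = i" "\<forall>i<n. adj (p i) (p (Suc i))"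
    unfolding n_def using geodesic_segment by blast
  have "\<exists>f. f 0 = w \<and> (\<forall>i. adj (f i) (f (Suc i)) \<and> d x (f (Suc i)) = Suc (d x (f i)))"
    using dependent_nat_choice[of "\<lambda>i y. i = 0 \<longrightarrow> y = w"
          "\<lambda>i y z. adj y z \<and> d x z = Suc (d x y)"] forward_neighbour_exists by auto
  then obtain f where f: "f 0 = w" "\<And>i. adj (f i) (f (Suc i))" "\<And>i. d x (f (Suc i)) = Suc (d x (f i))"
    by blast
  have fd: "d x (f i) = n + i" for i by (induction i) (use f n_def in auto)
  define r where "r i = (if i \<le> n then p i else f (i - n))" for i
  have "adj (r i) (r (Suc i))" for i
  proof -
    consider "i < n" | "i = n" | "i > n" by linarith
    then show ?thesis
    proof cases
      case 3
      then have "Suc i - n = Suc (i - n)" by simp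
      then show ?thesis using 3 f(2)[of "i - n"] by (simp add: r_def)
    qed (use p f(2)[of 0] f(1) in \<open>auto simp: r_def\<close>)
  qed
  moreover have "d x (r i) = i" for i using p fd by (auto simp: r_def)
  ultimately have "ray_from x r" by (simp add: ray_from_def)
  moreover have "r (d x w) = w" using p by (simp add: r_def n_def[symmetric])
  ultimately show ?thesis by blast
qed

lemma vertex_at_distance: "\<exists>y. d x y = n"
  using ray_through[of x x] ray_from_dist by blast

lemma finite_ball: "finite {y. d x y \<le> n}"
proof (induction n)
  case 0
  have "{y. d x y \<le> 0} = {x}" by auto
  then show ?case by simp
next
  case (Suc n)
  have "{y. d x y \<le> Suc n} \<subseteq> {y. d x y \<le> n} \<union> (\<Union>z\<in>{y. d x y \<le> n}. nbrs z)"
  proof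
    fix y assume "y \<in> {y. d x y \<le> Suc n}"
    then consider "d x y \<le> n" | "d x y = Suc n" by force
    then show "y \<in> {y. d x y \<le> n} \<union> (\<Union>z\<in>{y. d x y \<le> n}. nbrs z)"
    proof cases
      case 2
      then obtain z where "adj y z" "d x z = n" using dist_Suc_obtain by blast
      then show ?thesis using adj_sym by (auto simp: nbrs_def)
    qed auto
  qed
  then show ?case by (rule finite_subset) (use Suc finite_nbrs in auto)
qed

lemma countable_vertices: "countable (UNIV :: 'v set)"
proof -
  have "countable (\<Union>n. {y. d x y \<le> n})" for x
    using countable_finite[OF finite_ball] by (intro countable_UN[OF countableI_type])
  moreover have "(\<Union>n. {y. d x y \<le> n}) = UNIV" for x by auto
  ultimately show ?thesis by metis
qed

end

text \<open>The inverse of a bijection; \<open>inv\<close> denotes the inverse in a group.\<close>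

abbreviation finv :: "('a \<Rightarrow> 'b) \<Rightarrow> 'b \<Rightarrow> 'a" where "finv \<equiv> inv_into UNIV"

lemma finite_antimono_pigeonhole:
  fixes P :: "nat \<Rightarrow> 'a \<Rightarrow> bool"
  assumes "finite A" "\<And>n. \<exists>a\<in>A. P n a" "\<And>m n a. m \<le> n \<Longrightarrow> P n a \<Longrightarrow> P m a"
  shows "\<exists>a\<in>A. \<forall>n. P n a"
proof (rule ccontr)
  assume "\<not> ?thesis"
  then obtain f where f: "\<And>a. a \<in> A \<Longrightarrow> \<not> P (f a) a" by metis
  obtain a where a: "a \<in> A" "P (Max (f ` A)) a" using assms(2) by blast
  have "f a \<le> Max (f ` A)" using a assms(1) by simp
  then show False using f a assms(3) by blast
qed

context regular_tree_graph
begin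

lemma ray_segment_dist: "ray_from x r \<Longrightarrow> d (r i) (r (i + k)) = k"
proof -
  assume r: "ray_from x r"
  have "d (r i) (r (i + k)) \<le> k"
  proof (induction k)
    case (Suc k)
    then show ?case using dist_triangle[of "r i" "r (i + Suc k)" "r (i + k)"]
        dist_adj[OF ray_from_adj[OF r, of "i + k"]] by simp
  qed simp
  moreover have "i + k \<le> i + d (r i) (r (i + k))"
    using dist_triangle[of x "r (i + k)" "r i"] ray_from_dist[OF r] by simp
  ultimately show ?thesis by simp
qed

text \<open>Baire's theorem for the boundary: if countably many closed sets of rays cover all rays
  from \<open>x\<close>, one of them contains a cone. Otherwise one chooses cones inside each other, the
  \<open>j\<close>-th of which misses the \<open>j\<close>-th set, and the ray in their intersection is not
  covered.\<close>

lemma Baire_rays: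
  fixes F :: "nat \<Rightarrow> (nat \<Rightarrow> 'v) set"
  assumes closed: "\<And>j s. ray_from x s \<Longrightarrow> (\<And>N. \<exists>s'\<in>F j. \<forall>i\<le>N. s' i = s i) \<Longrightarrow> s \<in> F j"
    and cover: "\<And>s. ray_from x s \<Longrightarrow> \<exists>j. s \<in> F j"
  shows "\<exists>j s N. ray_from x s \<and> (\<forall>s'. ray_from x s' \<longrightarrow> s' N = s N \<longrightarrow> s' \<in> F j)"
proof (rule ccontr)
  assume not: "\<not> ?thesis"
  have step: "\<exists>s' N'. ray_from x s' \<and> s' N = s N \<and> N < N' \<and> (\<forall>t\<in>F j. \<exists>i\<le>N'. t i \<noteq> s' i)"
    if s: "ray_from x s" for j s N
  proof -
    obtain s' where s': "ray_from x s'" "s' N = s N" "s' \<notin> F j" using not s by blast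
    have "\<not> (\<forall>N. \<exists>t\<in>F j. \<forall>i\<le>N. t i = s' i)" using closed[OF s'(1), of j] s'(3) by metis
    then obtain N0 where N0: "\<And>t. t \<in> F j \<Longrightarrow> \<exists>i\<le>N0. t i \<noteq> s' i" by metis
    have "\<forall>t\<in>F j. \<exists>i\<le>N0 + N + 1. t i \<noteq> s' i"
    proof
      fix t assume "t \<in> F j"
      then obtain i where "i \<le> N0" "t i \<noteq> s' i" using N0 by metis
      then show "\<exists>i\<le>N0 + N + 1. t i \<noteq> s' i" by (intro exI[of _ i]) simp
    qed
    moreover have "N < N0 + N + 1" by simp
    ultimately show ?thesis using s'(1,2) by blast
  qed
  obtain r0 where r0: "ray_from x r0" using ray_through by blast
  have "\<exists>f. (\<forall>j. ray_from x (fst (f j))) \<and>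
      (\<forall>j. fst (f (Suc j)) (snd (f j)) = fst (f j) (snd (f j)) \<and> snd (f j) < snd (f (Suc j)) \<and>
         (\<forall>t\<in>F j. \<exists>i\<le>snd (f (Suc j)). t i \<noteq> fst (f (Suc j)) i))"
  proof -
    have "\<exists>f. \<forall>j. ray_from x (fst (f j)) \<and>
      (fst (f (Suc j)) (snd (f j)) = fst (f j) (snd (f j)) \<and> snd (f j) < snd (f (Suc j)) \<and>
         (\<forall>t\<in>F j. \<exists>i\<le>snd (f (Suc j)). t i \<noteq> fst (f (Suc j)) i))"
    proof (rule dependent_nat_choice, goal_cases)
      case 1
      show ?case using r0 by (intro exI[of _ "(r0, 0)"]) simp
    next
      case (2 p j)
      show ?case using step[OF 2, of "snd p" j] by auto
    qed
    then show ?thesis by blast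
  qed
  then obtain f where f: "\<And>j. ray_from x (fst (f j))"
    "\<And>j. fst (f (Suc j)) (snd (f j)) = fst (f j) (snd (f j))" "\<And>j. snd (f j) < snd (f (Suc j))"
    "\<And>j t. t \<in> F j \<Longrightarrow> \<exists>i\<le>snd (f (Suc j)). t i \<noteq> fst (f (Suc j)) i" by blast
  define S N where "S j = fst (f j)" and "N j = snd (f j)" for j
  have ray: "ray_from x (S j)" and SN: "S (Suc j) (N j) = S j (N j)" and Nlt: "N j < N (Suc j)"
    and miss: "t \<in> F j \<Longrightarrow> \<exists>i\<le>N (Suc j). t i \<noteq> S (Suc j) i" for j t
    using f unfolding S_def N_def by auto
  have Nge: "j \<le> N j" for j
    by (induction j) (use Nlt in \<open>auto intro: Suc_leI le_less_trans\<close>)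
  have Nmono: "j \<le> k \<Longrightarrow> N j \<le> N k" for j k
    by (rule lift_Suc_mono_le[of N]) (use Nlt less_imp_le in auto)
  have agree: "j \<le> k \<Longrightarrow> i \<le> N j \<Longrightarrow> S k i = S j i" for j k i
  proof (induction k rule: dec_induct)
    case (step k)
    have "S (Suc k) i = S k i"
      by (rule rays_agree_below[OF ray ray SN]) (use step Nmono[of j k] in simp)
    then show ?case using step by simp
  qed simp
  \<comment> \<open>Since \<open>i \<le> N i\<close>, the diagonal agrees with each \<open>S j\<close> up to \<open>N j\<close>.\<close>
  define t where "t i = S i i" for i
  have tS: "t i = S j i" if "i \<le> N j" for i j
    using agree[of i j i] agree[of j i i] Nge[of i] that unfolding t_def by (cases "i \<le> j") auto
  have "ray_from x t"
    unfolding ray_from_def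
  proof (intro allI conjI)
    fix i
    show "d x (t i) = i" unfolding t_def using ray ray_from_dist by blast
    have "t i = S (Suc i) i" "t (Suc i) = S (Suc i) (Suc i)" using tS Nge[of "Suc i"] by auto
    then show "adj (t i) (t (Suc i))" using ray ray_from_adj by metis
  qed
  then obtain j where "t \<in> F j" using cover by blast
  then show False using miss[of t j] tS by blast
qed

end

section \<open>Groups transitive on vertices and on the boundary\<close>

locale boundary_transitive_group = regular_tree_graph adj q
  for adj :: "'v \<Rightarrow> 'v \<Rightarrow> bool" and q :: nat +
  fixes G :: "('v \<Rightarrow> 'v) set" and x0 :: 'v
  assumes sub: "subgroup G (Aut adj)"
    and closed: "closedin (Aut_topology adj) G"
    and vertex_trans: "vertex_transitive G"
    and boundary_trans: "boundary_transitive adj G"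
begin

lemma carrier_Aut: "f \<in> carrier (Aut adj) \<longleftrightarrow> bij f \<and> (\<forall>x y. adj (f x) (f y) \<longleftrightarrow> adj x y)"
  by (simp add: Aut_def)

lemma G_bij: "g \<in> G \<Longrightarrow> bij g" and G_adj: "g \<in> G \<Longrightarrow> adj (g x) (g y) \<longleftrightarrow> adj x y"
  using subgroup.subset[OF sub] carrier_Aut by auto

lemma inv_apply [simp]: "g \<in> G \<Longrightarrow> finv g (g x) = x" and apply_inv [simp]: "g \<in> G \<Longrightarrow> g (finv g x) = x"
  using G_bij by (auto simp: bij_is_inj bij_is_surj surj_f_inv_f)

lemma G_comp: "g \<in> G \<Longrightarrow> h \<in> G \<Longrightarrow> g \<circ> h \<in> G"
  using subgroup.m_closed[OF sub, of g h] by (simp add: Aut_def)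

lemma G_id: "id \<in> G"
  using subgroup.one_closed[OF sub] by (simp add: Aut_def)

lemma m_inv_Aut:
  assumes "g \<in> H" "bij g" "finv g \<in> H"
  shows "inv\<^bsub>(Aut adj)\<lparr>carrier := H\<rparr>\<^esub> g = finv g"
  unfolding m_inv_def
proof (rule the_equality)
  show "finv g \<in> carrier (Aut adj\<lparr>carrier := H\<rparr>) \<and>
    g \<otimes>\<^bsub>Aut adj\<lparr>carrier := H\<rparr>\<^esub> finv g = \<one>\<^bsub>Aut adj\<lparr>carrier := H\<rparr>\<^esub> \<and>
    finv g \<otimes>\<^bsub>Aut adj\<lparr>carrier := H\<rparr>\<^esub> g = \<one>\<^bsub>Aut adj\<lparr>carrier := H\<rparr>\<^esub>"
    using assms by (auto simp: Aut_def bij_is_inj bij_is_surj surj_iff[symmetric])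
next
  fix y
  assume "y \<in> carrier (Aut adj\<lparr>carrier := H\<rparr>) \<and>
    g \<otimes>\<^bsub>Aut adj\<lparr>carrier := H\<rparr>\<^esub> y = \<one>\<^bsub>Aut adj\<lparr>carrier := H\<rparr>\<^esub> \<and>
    y \<otimes>\<^bsub>Aut adj\<lparr>carrier := H\<rparr>\<^esub> g = \<one>\<^bsub>Aut adj\<lparr>carrier := H\<rparr>\<^esub>"
  then have "g \<circ> y = id" "y \<circ> g = id" by (auto simp: Aut_def)
  then show "y = finv g" by (metis inv_unique_comp)
qed

lemma G_inv: "g \<in> G \<Longrightarrow> finv g \<in> G"
proof -
  assume g: "g \<in> G"
  have "g \<in> carrier (Aut adj)" using g subgroup.subset[OF sub] by blast
  have b: "bij (finv g)" using G_bij[OF g] bij_imp_bij_inv by blast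
  have "adj (finv g x) (finv g y) \<longleftrightarrow> adj x y" for x y
    using G_adj[OF g, of "finv g x" "finv g y"] g by simp
  then have "finv g \<in> carrier (Aut adj)" using b carrier_Aut by blast
  then have "inv\<^bsub>Aut adj\<^esub> g = finv g"
    using m_inv_Aut[of g "carrier (Aut adj)"] \<open>g \<in> carrier (Aut adj)\<close> G_bij[OF g] by simp
  then show ?thesis using subgroup.m_inv_closed[OF sub g] by simp
qed

lemma G_walk: "g \<in> G \<Longrightarrow> (adj ^^ n) x y \<Longrightarrow> (adj ^^ n) (g x) (g y)"
proof (induction n arbitrary: y)
  case (Suc n)
  then obtain z where "(adj ^^ n) x z" "adj z y" by auto
  then show ?case using Suc G_adj by (auto intro!: relcomppI)
qed simp

lemma G_dist: "g \<in> G \<Longrightarrow> d (g x) (g y) = d x y"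
proof -
  have le: "g \<in> G \<Longrightarrow> d (g x) (g y) \<le> d x y" for g x y
    using dist_le G_walk dist_walk by blast
  assume g: "g \<in> G"
  show ?thesis using le[OF g, of x y] le[OF G_inv[OF g], of "g x" "g y"] g by simp
qed

lemma G_nbrs: "g \<in> G \<Longrightarrow> bij_betw g (nbrs x) (nbrs (g x))"
  unfolding bij_betw_def nbrs_def
proof
  assume g: "g \<in> G"
  show "inj_on g {y. adj x y}" using G_bij[OF g] by (meson bij_is_inj inj_on_subset subset_UNIV)
  show "g ` {y. adj x y} = {y. adj (g x) y}"
    using G_adj[OF g] g by (auto simp: image_iff) (metis apply_inv)
qed

lemma vertex_trans_obtain: obtains g where "g \<in> G" "g x = y"
  using vertex_trans unfolding vertex_transitive_def by blast

lemma G_closed_limit: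
  assumes h: "h \<in> carrier (Aut adj)"
    and lim: "\<And>A. finite A \<Longrightarrow> \<exists>g\<in>G. \<forall>z\<in>A. g z = h z"
  shows "h \<in> G"
proof (rule ccontr)
  assume "h \<notin> G"
  have top: "topspace (Aut_topology adj) = carrier (Aut adj)"
    unfolding Aut_topology_def by simp
  have "openin (Aut_topology adj) (carrier (Aut adj) - G)"
    using closed top unfolding closedin_def by simp
  then obtain V where V: "openin (product_topology (\<lambda>_. discrete_topology UNIV) UNIV) V"
    "carrier (Aut adj) - G = V \<inter> carrier (Aut adj)"
    unfolding Aut_topology_def openin_subtopology by blast
  have "h \<in> V" using h \<open>h \<notin> G\<close> V(2) by blast
  then obtain U where U: "finite {i. U i \<noteq> (UNIV :: 'v set)}" "h \<in> Pi\<^sub>E UNIV U" "Pi\<^sub>E UNIV U \<subseteq> V"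
    using V(1) unfolding openin_product_topology_alt by fastforce
  obtain g where g: "g \<in> G" "\<forall>z\<in>{i. U i \<noteq> UNIV}. g z = h z" using lim[OF U(1)] by blast
  have "g z \<in> U z" for z using g(2) U(2) by (cases "U z = UNIV") auto
  then have "g \<in> V" using U(3) by (auto simp: PiE_UNIV_domain)
  then show False using g(1) V(2) subgroup.subset[OF sub] by blast
qed

text \<open>The elements of \<open>G\<close> that move \<open>x\<close> to \<open>y\<close> form a compact set. They move every vertex
  within a finite ball, so a diagonal sequence along which the maps and their inverses are
  eventually constant at each vertex exists. Controlling the inverses makes the limit
  surjective.\<close>

lemma transporter_compact:
  assumes gG: "\<And>N. g N \<in> G" and gxy: "\<And>N. g N x = y"
  shows "\<exists>h\<in>G. \<forall>A n. finite A \<longrightarrow> (\<exists>N\<ge>n::nat. \<forall>z\<in>A. g N z = h z)"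
proof -
  define e where "e = from_nat_into (UNIV :: 'v set)"
  have e: "\<exists>n. e n = z" for z
    unfolding e_def using from_nat_into_surj[OF countable_vertices, of z] by simp
  define P where "P n s \<longleftrightarrow> (\<exists>a b. \<forall>i. g (s i) (e n) = a \<and> finv (g (s i)) (e n) = b)"
    for n and s :: "nat \<Rightarrow> nat"
  interpret subseqs P
  proof
    fix n and s :: "nat \<Rightarrow> nat" assume "strict_mono s"
    define F where "F i = (g (s i) (e n), finv (g (s i)) (e n))" for i
    have "range F \<subseteq> {z. d y z \<le> d x (e n)} \<times> {z. d x z \<le> d y (e n)}"
    proof
      fix p assume "p \<in> range F"
      then obtain i where p: "p = (g (s i) (e n), finv (g (s i)) (e n))" unfolding F_def by blast
      have "d y (g (s i) (e n)) = d x (e n)" using G_dist[OF gG[of "s i"], of x "e n"] gxy by simp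
      moreover have "d x (finv (g (s i)) (e n)) = d y (e n)"
        using G_dist[OF gG[of "s i"], of x "finv (g (s i)) (e n)"] gxy gG by simp
      ultimately show "p \<in> {z. d y z \<le> d x (e n)} \<times> {z. d x z \<le> d y (e n)}" using p by simp
    qed
    then have "finite (range F)" by (rule finite_subset) (intro finite_cartesian_product finite_ball)
    then obtain i0 where "infinite {i. F i = F i0}"
      using pigeonhole_infinite[of UNIV F] by auto
    then obtain r :: "nat \<Rightarrow> nat" where r: "strict_mono r" "\<forall>i. r i \<in> {i. F i = F i0}"
      using infinite_enumerate by blast
    have "P n (s \<circ> r)" unfolding P_def using r(2) by (auto simp: F_def)
    then show "\<exists>r'. strict_mono r' \<and> P n (s \<circ> r')" using r(1) by blast
  qed
  have "P n (diagseq \<circ> (+) (Suc n))" for n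
  proof (rule diagseq_holds)
    fix s r n assume "P n r" then show "P n (r \<circ> s)" unfolding P_def by auto
  qed
  then have "\<forall>n. \<exists>a b. \<forall>i. g (diagseq (Suc n + i)) (e n) = a \<and> finv (g (diagseq (Suc n + i))) (e n) = b"
    unfolding P_def by simp
  then have "\<forall>z. \<exists>a b k. \<forall>i\<ge>k. g (diagseq i) z = a \<and> finv (g (diagseq i)) z = b"
    by (metis e le_add_diff_inverse)
  then obtain h h' k where hk: "\<And>z i. i \<ge> k z \<Longrightarrow> g (diagseq i) z = h z"
     "\<And>z i. i \<ge> k z \<Longrightarrow> finv (g (diagseq i)) z = h' z" by metis
  have "h (h' z) = z" for z
  proof -
    let ?i = "max (k z) (k (h' z))"
    have "g (diagseq ?i) (h' z) = h (h' z)" "finv (g (diagseq ?i)) z = h' z" using hk by auto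
    then show ?thesis using gG by (metis apply_inv)
  qed
  moreover have "h' (h z) = z" for z
  proof -
    let ?i = "max (k z) (k (h z))"
    have "finv (g (diagseq ?i)) (h z) = h' (h z)" "g (diagseq ?i) z = h z" using hk by auto
    then show ?thesis using gG by (metis inv_apply)
  qed
  ultimately have "bij h" by (metis bijI')
  moreover have "adj (h a) (h b) \<longleftrightarrow> adj a b" for a b
  proof -
    let ?i = "max (k a) (k b)"
    have "g (diagseq ?i) a = h a" "g (diagseq ?i) b = h b" using hk by auto
    then show ?thesis using G_adj[OF gG] by metis
  qed
  ultimately have hA: "h \<in> carrier (Aut adj)" using carrier_Aut by blast
  have lim: "\<exists>N\<ge>n. \<forall>z\<in>A. g N z = h z" if "finite A" for A n
  proof -
    define i where "i = Max (insert n (k ` A))"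
    have "n \<le> i" "\<forall>z\<in>A. k z \<le> i" unfolding i_def using that by auto
    moreover have "i \<le> diagseq i" using subseq_diagseq by (simp add: strict_mono_imp_increasing)
    ultimately show ?thesis using hk(1) by (intro exI[of _ "diagseq i"]) auto
  qed
  have "h \<in> G" by (rule G_closed_limit[OF hA]) (use lim gG in blast)
  then show ?thesis using lim by blast
qed

lemma boundary_shift:
  assumes "ray_from x0 r" "ray_from x0 s"
  shows "\<exists>g\<in>G. \<exists>m n. \<forall>k. g (r (m + k)) = s (n + k)"
proof -
  have "cofinal_rel adj `` {r} \<in> tree_boundary adj" "cofinal_rel adj `` {s} \<in> tree_boundary adj"
    unfolding tree_boundary_def using assms ray_from_in_rays by (auto intro: quotientI)
  then obtain g where g: "g \<in> G"
    "(\<lambda>r. g \<circ> r) ` (cofinal_rel adj `` {r}) = cofinal_rel adj `` {s}"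
    using boundary_trans unfolding boundary_transitive_def by meson
  have "r \<in> cofinal_rel adj `` {r}"
    unfolding cofinal_rel_def using ray_from_in_rays[OF assms(1)] by auto
  then have "g \<circ> r \<in> cofinal_rel adj `` {s}" using g(2) by blast
  then obtain m n where "\<forall>k. s (m + k) = g (r (n + k))"
    unfolding cofinal_rel_def by auto
  then show ?thesis using g(1) by metis
qed

text \<open>The orbits of the stabiliser of \<open>x0\<close> on the boundary are open. The sets \<open>E m n y\<close>
  in the proof consist of the rays that are equivalent, with shifts \<open>m\<close> and \<open>n\<close>, to a
  translate of \<open>r\<close> by an element that moves \<open>x0\<close> to \<open>y\<close>. They are closed by
  compactness of these elements and cover the boundary by transitivity, so one of them contains
  the cone of some ray \<open>s\<close>. An element \<open>g\<close> that carries \<open>r\<close> to \<open>s\<close> carries a cone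
  around \<open>r\<close> into this cone, and two elements with the same value \<open>y\<close> at \<open>x0\<close> differ
  by an element of the stabiliser.\<close>

lemma stabiliser_orbit_open:
  assumes r: "ray_from x0 r"
  shows "\<exists>M. \<forall>r'. ray_from x0 r' \<longrightarrow> r' M = r M \<longrightarrow> (\<exists>h\<in>G. h x0 = x0 \<and> (\<forall>k\<ge>M. h (r k) = r' k))"
proof -
  define c where "c = from_nat_into (UNIV :: (nat \<times> nat \<times> 'v) set)"
  have cs: "\<exists>j. c j = p" for p
  proof -
    have "countable (UNIV \<times> (UNIV \<times> UNIV) :: (nat \<times> nat \<times> 'v) set)"
      using countable_vertices by (intro countable_SIGMA) auto
    then have "countable (UNIV :: (nat \<times> nat \<times> 'v) set)" by simp
    from from_nat_into_surj[OF this, of p] show ?thesis unfolding c_def by simp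
  qed
  define E where "E m n y = {s. \<exists>g\<in>G. g x0 = y \<and> (\<forall>k. g (r (m + k)) = s (n + k))}" for m n y
  define F where "F j = (case c j of (m, n, y) \<Rightarrow> E m n y)" for j
  have "\<exists>j s N. ray_from x0 s \<and> (\<forall>s'. ray_from x0 s' \<longrightarrow> s' N = s N \<longrightarrow> s' \<in> F j)"
  proof (rule Baire_rays)
    fix s assume "ray_from x0 s"
    then obtain g m n where "g \<in> G" "\<forall>k. g (r (m + k)) = s (n + k)"
      using boundary_shift[OF r] by blast
    then have "s \<in> E m n (g x0)" unfolding E_def by blast
    moreover obtain j where "c j = (m, n, g x0)" using cs by blast
    ultimately have "s \<in> F j" by (simp add: F_def)
    then show "\<exists>j. s \<in> F j" by blast
  next
    fix j s assume s: "ray_from x0 s" "\<And>N. \<exists>s'\<in>F j. \<forall>i\<le>N. s' i = s i"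
    obtain m n y where c: "c j = (m, n, y)" by (cases "c j")
    have "\<exists>g\<in>G. g x0 = y \<and> (\<forall>k. n + k \<le> N \<longrightarrow> g (r (m + k)) = s (n + k))" for N
    proof -
      obtain s' where "s' \<in> E m n y" "\<forall>i\<le>N. s' i = s i" using s(2)[of N] c by (auto simp: F_def)
      then show ?thesis unfolding E_def by auto
    qed
    then obtain g where g: "\<And>N. g N \<in> G" "\<And>N. g N x0 = y"
      "\<And>N k. n + k \<le> N \<Longrightarrow> g N (r (m + k)) = s (n + k)" by metis
    obtain h where h: "h \<in> G" "\<And>A n. finite A \<Longrightarrow> \<exists>N\<ge>n. \<forall>z\<in>A. g N z = h z"
      using transporter_compact[of g, OF g(1,2)] by blast
    have "h x0 = y" using h(2)[of "{x0}" 0] g(2) by auto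
    moreover have "h (r (m + k)) = s (n + k)" for k
    proof -
      obtain N where "N \<ge> n + k" "g N (r (m + k)) = h (r (m + k))"
        using h(2)[of "{r (m + k)}" "n + k"] by auto
      then show ?thesis using g(3)[of k N] by simp
    qed
    ultimately show "s \<in> F j" using h(1) c by (auto simp: F_def E_def)
  qed
  then obtain j s N0 where s: "ray_from x0 s" "\<And>s'. ray_from x0 s' \<Longrightarrow> s' N0 = s N0 \<Longrightarrow> s' \<in> F j"
    by blast
  obtain m n y where c: "c j = (m, n, y)" by (cases "c j")
  \<comment> \<open>The bound \<open>n + 1\<close> makes one whole edge of \<open>s\<close> before \<open>N\<close> lie in the image of \<open>r\<close>, so that the glued path \<open>s'\<close> below does not backtrack at \<open>N\<close>.\<close>
  define N where "N = max N0 (n + 1)"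
  define M where "M = m + (N - n)"
  have FE: "F j = E m n y" using c by (simp add: F_def)
  obtain g where g: "g \<in> G" "g x0 = y" "\<And>k. g (r (m + k)) = s (n + k)"
    using s(2)[OF s(1)] FE unfolding E_def by blast
  show ?thesis
  proof (intro exI[of _ M] allI impI)
    fix r' assume r': "ray_from x0 r'" "r' M = r M"
    define s' where "s' i = (if i \<le> N then s i else g (r' (m + (i - n))))" for i
    have s'g: "s' i = g (r' (m + (i - n)))" if "i \<ge> n" for i
    proof (cases "i \<le> N")
      case True
      then have "r' (m + (i - n)) = r (m + (i - n))"
        by (intro rays_agree_below[OF r'(1) r r'(2)]) (simp add: M_def)
      then show ?thesis using True that g(3)[of "i - n"] by (simp add: s'_def)
    qed (simp add: s'_def)
    have "ray_from x0 s'"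
    proof (rule nonbacktracking_ray[where N = N])
      fix i
      show "adj (s' i) (s' (Suc i))"
      proof (cases "i < N")
        case True then show ?thesis using ray_from_adj[OF s(1)] by (simp add: s'_def)
      next
        case False
        then have "i \<ge> n" by (simp add: N_def)
        then have "s' i = g (r' (m + (i - n)))" "s' (Suc i) = g (r' (Suc (m + (i - n))))"
          using s'g[of i] s'g[of "Suc i"] by (auto simp: Suc_diff_le)
        then show ?thesis using G_adj[OF g(1)] ray_from_adj[OF r'(1)] by simp
      qed
      assume "N \<le> Suc i"
      then have "i \<ge> n" by (simp add: N_def)
      then have "s' i = g (r' (m + (i - n)))" "s' (Suc (Suc i)) = g (r' (Suc (Suc (m + (i - n)))))"
        using s'g[of i] s'g[of "Suc (Suc i)"] by (auto simp: Suc_diff_le)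
      then show "s' (Suc (Suc i)) \<noteq> s' i"
        using ray_from_inj[OF r'(1)] g(1) by (metis inv_apply n_not_Suc_n less_Suc_eq not_less_eq)
    next
      fix i assume "i \<le> N" then show "d x0 (s' i) = i"
        using ray_from_dist[OF s(1)] by (simp add: s'_def)
    qed (simp add: N_def)
    moreover have "s' N0 = s N0" by (simp add: s'_def N_def)
    ultimately have "s' \<in> E m n y" using s(2) FE by blast
    then obtain g1 where g1: "g1 \<in> G" "g1 x0 = y" "\<And>k. g1 (r (m + k)) = s' (n + k)"
      unfolding E_def by blast
    have "(finv g \<circ> g1) x0 = x0" using g g1 by (metis comp_apply inv_apply)
    moreover have "(finv g \<circ> g1) (r k) = r' k" if "k \<ge> M" for k
    proof -
      have "m \<le> k" using that by (simp add: M_def)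
      then have "g1 (r k) = g (r' k)" using g1(3)[of "k - m"] s'g[of "n + (k - m)"] by simp
      then show ?thesis using g by simp
    qed
    ultimately show "\<exists>h\<in>G. h x0 = x0 \<and> (\<forall>k\<ge>M. h (r k) = r' k)"
      using G_comp[OF G_inv[OF g(1)] g1(1)] by blast
  qed
qed

text \<open>The common stabiliser of \<open>x\<close> and \<open>w\<close> is transitive on the edges at \<open>w\<close> that
  lead away from \<open>x\<close>. Transitivity on spheres is this condition for all \<open>w\<close>, one radius
  at a time.\<close>

definition fork_transitive :: "'v \<Rightarrow> 'v \<Rightarrow> bool" where
  "fork_transitive x w \<longleftrightarrow> (\<forall>a b. adj w a \<longrightarrow> adj w b \<longrightarrow> d x a = Suc (d x w) \<longrightarrow> d x b = Suc (d x w) \<longrightarrow>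
      (\<exists>h\<in>G. h x = x \<and> h w = w \<and> h a = b))"

lemma fork_transitive_translate:
  assumes "g \<in> G" "fork_transitive (g x) (g w)" shows "fork_transitive x w"
  unfolding fork_transitive_def
proof (intro allI impI)
  fix a b assume "adj w a" "adj w b" "d x a = Suc (d x w)" "d x b = Suc (d x w)"
  then obtain h where h: "h \<in> G" "h (g x) = g x" "h (g w) = g w" "h (g a) = g b"
    using assms(2) G_adj[OF assms(1)] G_dist[OF assms(1)] unfolding fork_transitive_def by metis
  have "finv g \<circ> h \<circ> g \<in> G" using h assms G_comp G_inv by blast
  moreover have "(finv g \<circ> h \<circ> g) x = x" "(finv g \<circ> h \<circ> g) w = w" "(finv g \<circ> h \<circ> g) a = b"
    using h assms by auto
  ultimately show "\<exists>h\<in>G. h x = x \<and> h w = w \<and> h a = b" by blast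
qed

text \<open>An automorphism that fixes \<open>z\<close> and \<open>w\<close> fixes the geodesic between them, so the
  condition becomes weaker when \<open>z\<close> is replaced by a vertex of the geodesic.\<close>

lemma fork_transitive_shorten:
  assumes "w \<noteq> x" "d z x + d x w = d z w" "fork_transitive z w"
  shows "fork_transitive x w"
  unfolding fork_transitive_def
proof (intro allI impI)
  fix a b assume a: "adj w a" "adj w b" "d x a = Suc (d x w)" "d x b = Suc (d x w)"
  have par: "parent x w = parent z w"
  proof (rule parent_unique)
    show "adj w (parent x w)" using parent assms(1) by blast
    show "d z (parent x w) \<le> d z w"
      using dist_triangle[of z "parent x w" x] parent(2)[OF assms(1)] assms(2) by simp
  qed
  have "a \<noteq> parent x w" "b \<noteq> parent x w" using a parent(2)[OF assms(1)] by auto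
  then have "d z a = Suc (d z w)" "d z b = Suc (d z w)" using forward_neighbour a par by auto
  then obtain h where h: "h \<in> G" "h z = z" "h w = w" "h a = b"
    using assms(3) a unfolding fork_transitive_def by blast
  have "x = h x"
    by (rule between_unique[OF assms(2)]) (use G_dist[OF h(1), of z x] G_dist[OF h(1), of x w] h in auto)
  then show "\<exists>h\<in>G. h x = x \<and> h w = w \<and> h a = b" using h by metis
qed

text \<open>Rays that fork at a vertex \<open>w\<close> of the cone of \<open>r\<close> are both images of \<open>r\<close> under
  the stabiliser.\<close>

lemma open_orbit_fork_transitive:
  assumes r: "ray_from x0 r"
  shows "\<exists>M. \<forall>w. d x0 w = M + d (r M) w \<longrightarrow> fork_transitive x0 w"
proof -
  obtain M where M: "\<And>r'. ray_from x0 r' \<Longrightarrow> r' M = r M \<Longrightarrow> \<exists>h\<in>G. h x0 = x0 \<and> (\<forall>k\<ge>M. h (r k) = r' k)"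
    using stabiliser_orbit_open[OF r] by blast
  have "fork_transitive x0 w" if w: "d x0 w = M + d (r M) w" for w
    unfolding fork_transitive_def
  proof (intro allI impI)
    define k where "k = d x0 w"
    have *: "\<exists>h\<in>G. h x0 = x0 \<and> h (r k) = w \<and> h (r (Suc k)) = a"
      if a: "adj w a" "d x0 a = Suc (d x0 w)" for a
    proof -
      obtain s where s: "ray_from x0 s" "s (d x0 a) = a" using ray_through by blast
      have sa: "s (Suc k) = a" using s a k_def by simp
      have "w = parent x0 a" by (rule parent_unique) (use a adj_sym in auto)
      then have sw: "s k = w" using ray_from_parent[OF s(1), of k] sa by simp
      have Mk: "M \<le> k" using w k_def by simp
      have "d (s M) w = k - M" using ray_segment_dist[OF s(1), of M "k - M"] sw Mk by simp
      then have "r M = s M"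
        using w k_def by (intro between_unique[of x0 _ w]) (auto simp: ray_from_dist[OF r] ray_from_dist[OF s(1)])
      then obtain h where "h \<in> G" "h x0 = x0" "\<forall>k\<ge>M. h (r k) = s k" using M[OF s(1)] by auto
      then show ?thesis using sa sw Mk by (intro bexI[of _ h]) auto
    qed
    fix a b assume "adj w a" "adj w b" "d x0 a = Suc (d x0 w)" "d x0 b = Suc (d x0 w)"
    then obtain h h' where h: "h \<in> G" "h x0 = x0" "h (r k) = w" "h (r (Suc k)) = a"
      and h': "h' \<in> G" "h' x0 = x0" "h' (r k) = w" "h' (r (Suc k)) = b"
      using *[of a] *[of b] by blast
    have "(h' \<circ> finv h) x0 = x0" "(h' \<circ> finv h) w = w" "(h' \<circ> finv h) a = b"
      using h h' by (metis comp_apply inv_apply)+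
    then show "\<exists>h\<in>G. h x0 = x0 \<and> h w = w \<and> h a = b" using h h' G_comp G_inv by blast
  qed
  then show ?thesis by blast
qed

text \<open>Koenig's argument: if there were exceptional vertices arbitrarily far from \<open>x0\<close>,
  some ray would have exceptional vertices in all of its cones.\<close>

lemma fork_transitive_far: "\<exists>n. \<forall>w. n \<le> d x0 w \<longrightarrow> fork_transitive x0 w"
proof (rule ccontr)
  assume "\<not> ?thesis"
  then have bad: "\<exists>w. n \<le> d x0 w \<and> \<not> fork_transitive x0 w" for n by blast
  define heavy where "heavy u \<longleftrightarrow> (\<forall>n. \<exists>w. \<not> fork_transitive x0 w \<and> d x0 w = d x0 u + d u w \<and> n \<le> d x0 w)" for u
  have "heavy x0" unfolding heavy_def using bad by auto
  have child: "\<exists>u'. heavy u' \<and> adj u u' \<and> d x0 u' = Suc (d x0 u)" if u: "heavy u" for u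
  proof -
    define P where "P n u' \<longleftrightarrow> d x0 u' = Suc (d x0 u) \<and>
      (\<exists>w. \<not> fork_transitive x0 w \<and> d x0 w = d x0 u' + d u' w \<and> n \<le> d x0 w)" for n u'
    have "\<exists>u'\<in>nbrs u. \<forall>n. P n u'"
    proof (rule finite_antimono_pigeonhole[OF finite_nbrs])
      fix n
      obtain w where w: "\<not> fork_transitive x0 w" "d x0 w = d x0 u + d u w" "n + Suc (d x0 u) \<le> d x0 w"
        using u unfolding heavy_def by blast
      have "u \<noteq> w" using w by auto
      define u' where "u' = parent w u"
      have u': "adj u u'" "d w u = Suc (d w u')" using parent[OF \<open>u \<noteq> w\<close>] u'_def by auto
      have "d u w = Suc (d u' w)" using u'(2) dist_sym by metis
      moreover have "d x0 w \<le> d x0 u' + d u' w" by (rule dist_triangle)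
      moreover have "d x0 u' \<le> Suc (d x0 u)" using dist_triangle[of x0 u' u] dist_adj[OF u'(1)] by simp
      ultimately have "P n u'" unfolding P_def using w by (intro conjI exI[of _ w]) auto
      then show "\<exists>u'\<in>nbrs u. P n u'" using u'(1) unfolding nbrs_def by blast
    next
      fix m n a assume "m \<le> n" "P n a"
      then show "P m a" unfolding P_def by (meson le_trans)
    qed
    then show ?thesis unfolding P_def heavy_def nbrs_def by blast
  qed
  have "\<exists>f. f 0 = x0 \<and> (\<forall>n. heavy (f n) \<and> adj (f n) (f (Suc n)) \<and> d x0 (f (Suc n)) = Suc (d x0 (f n)))"
    using dependent_nat_choice[of "\<lambda>n u. heavy u \<and> (n = 0 \<longrightarrow> u = x0)"
        "\<lambda>n u u'. adj u u' \<and> d x0 u' = Suc (d x0 u)"] child \<open>heavy x0\<close> by auto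
  then obtain f where f: "f 0 = x0" "\<And>n. heavy (f n)" "\<And>n. adj (f n) (f (Suc n))"
    "\<And>n. d x0 (f (Suc n)) = Suc (d x0 (f n))" by blast
  have fd: "d x0 (f n) = n" for n by (induction n) (use f in auto)
  then have "ray_from x0 f" using f by (simp add: ray_from_def)
  then obtain M where "\<And>w. d x0 w = M + d (f M) w \<Longrightarrow> fork_transitive x0 w"
    using open_orbit_fork_transitive by blast
  then show False using f(2)[of M] fd unfolding heavy_def by metis
qed

text \<open>Extending the geodesic from \<open>w\<close> to \<open>x\<close> beyond \<open>x\<close> up to a far vertex \<open>z\<close> and
  moving \<open>z\<close> to \<open>x0\<close> reduces the claim to vertices far from \<open>x0\<close>.\<close>

lemma fork_transitive_neq:
  assumes "w \<noteq> x" shows "fork_transitive x w"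
proof -
  obtain n where n: "\<And>w. n \<le> d x0 w \<Longrightarrow> fork_transitive x0 w" using fork_transitive_far by blast
  obtain s where s: "ray_from w s" "s (d w x) = x" using ray_through by blast
  define z where "z = s (d w x + n)"
  have zw: "d z w = d w x + n" using ray_from_dist[OF s(1)] dist_sym by (simp add: z_def)
  have zx: "d z x = n" using ray_segment_dist[OF s(1), of "d w x" n] s(2) dist_sym by (simp add: z_def)
  obtain g where g: "g \<in> G" "g z = x0" using vertex_trans_obtain by blast
  have "n \<le> d x0 (g w)" using G_dist[OF g(1), of z w] g zw by simp
  then have "fork_transitive (g z) (g w)" using n g by simp
  then have "fork_transitive z w" using fork_transitive_translate g by blast
  moreover have "d z x + d x w = d z w" using zw zx dist_sym[of x w] by simp
  ultimately show ?thesis using fork_transitive_shorten assms by blast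
qed

lemma fork_transitive: "fork_transitive x w"
proof (cases "w = x")
  case True
  show ?thesis
    unfolding fork_transitive_def
  proof (intro allI impI)
    fix a b assume a: "adj w a" "adj w b"
    \<comment> \<open>For \<open>w = x\<close> a third neighbour \<open>c\<close> of \<open>w\<close> exists because \<open>q + 1 \<ge> 3\<close>, and seen from it both \<open>a\<close> and \<open>b\<close> lead away.\<close>
    have "card (nbrs w - {a, b}) \<ge> 1"
      using card_nbrs[of w] q2 finite_nbrs[of w] diff_card_le_card_Diff[of "{a, b}" "nbrs w"]
        card_insert_le_m1[of 2 "{b}" a] by simp
    then obtain c where c: "c \<in> nbrs w" "c \<noteq> a" "c \<noteq> b"
      by (metis Diff_iff card.empty equals0I insert_iff not_one_le_zero)
    have "adj w c" using c by (simp add: nbrs_def)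
    have "w \<noteq> c" using adj_irrefl \<open>adj w c\<close> by auto
    have pc: "c = parent c w" by (rule parent_unique) (use \<open>adj w c\<close> in auto)
    then have "d c a = Suc (d c w)" "d c b = Suc (d c w)" using forward_neighbour a c by metis+
    then obtain h where "h \<in> G" "h c = c" "h w = w" "h a = b"
      using fork_transitive_neq[OF \<open>w \<noteq> c\<close>] a unfolding fork_transitive_def by blast
    then show "\<exists>h\<in>G. h x = x \<and> h w = w \<and> h a = b" using True by blast
  qed
qed (rule fork_transitive_neq)

theorem sphere_transitive:
  assumes "d x u = d x v" shows "\<exists>h\<in>G. h x = x \<and> h u = v"
  using assms
proof (induction "d x u" arbitrary: u v)
  case 0
  then show ?case using G_id by (intro bexI[of _ id]) auto
next
  case (Suc n)
  obtain u' where u': "adj u u'" "d x u' = n" using Suc.hyps(2) dist_Suc_obtain by metis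
  obtain v' where v': "adj v v'" "d x v' = n" using Suc.hyps(2) Suc.prems dist_Suc_obtain by metis
  obtain h where h: "h \<in> G" "h x = x" "h u' = v'" using Suc.hyps(1)[of u' v'] u' v' by auto
  have "adj v' (h u)" using G_adj[OF h(1), of u' u] h u' adj_sym by auto
  moreover have "d x (h u) = Suc n" using G_dist[OF h(1), of x u] h Suc.hyps(2) by simp
  ultimately obtain k where "k \<in> G" "k x = x" "k v' = v'" "k (h u) = v"
    using fork_transitive[of x v'] v' adj_sym Suc.prems Suc.hyps(2) unfolding fork_transitive_def by metis
  then show ?case using h G_comp by (intro bexI[of _ "k \<circ> h"]) auto
qed

end

section \<open>Radial kernels of negative type\<close>

text \<open>The scalar core of the bound for a symmetric operator \<open>M\<close>: with \<open>u n\<close> for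
  \<open>\<langle>M\<^sup>n \<alpha>, \<alpha>\<rangle>\<close> the first assumption is the Cauchy-Schwarz inequality. The even terms are
  log-convex, so if \<open>u 2\<close> exceeded \<open>u 0\<close> they would grow exponentially.\<close>

lemma polynomial_growth_log_convex:
  fixes u :: "nat \<Rightarrow> real"
  assumes cs: "\<And>i j. (u (i + j))\<^sup>2 \<le> u (2 * i) * u (2 * j)"
    and nonneg: "\<And>i. 0 \<le> u (2 * i)"
    and growth: "\<And>n. \<bar>u n\<bar> \<le> C * (real n + D)\<^sup>2"
  shows "\<bar>u 1\<bar> \<le> u 0"
proof -
  define v where "v n = u (2 * n)" for n
  have v: "(v (Suc n))\<^sup>2 \<le> v n * v (Suc (Suc n))" for n
  proof -
    have "n + (n + 2) = 2 * Suc n" "2 * (n + 2) = 2 * Suc (Suc n)" by simp_all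
    then show ?thesis using cs[of n "n + 2"] unfolding v_def by metis
  qed
  have v_le: "v 1 \<le> v 0"
  proof (rule ccontr)
    assume "\<not> v 1 \<le> v 0"
    then have lt: "v 0 < v 1" by simp
    have v0: "0 \<le> v 0" using nonneg[of 0] unfolding v_def by simp
    have "v 0 \<noteq> 0" using v[of 0] lt by auto
    then have v0: "0 < v 0" using v0 by simp
    define \<rho> where "\<rho> = v 1 / v 0"
    have \<rho>: "1 < \<rho>" using lt v0 by (simp add: \<rho>_def)
    have grow: "0 < v n \<and> \<rho> * v n \<le> v (Suc n)" for n
    proof (induction n)
      case 0
      then show ?case using v0 by (simp add: \<rho>_def)
    next
      case (Suc n)
      then have pos: "0 < v (Suc n)" using \<rho> by (smt (verit) mult_pos_pos)
      have "v (Suc n) * (\<rho> * v n) \<le> v (Suc n) * v (Suc n)" using Suc pos by simp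
      also have "\<dots> \<le> v n * v (Suc (Suc n))" using v[of n] by (simp add: power2_eq_square)
      finally have "v n * (\<rho> * v (Suc n)) \<le> v n * v (Suc (Suc n))" by (simp add: algebra_simps)
      then show ?case using Suc pos by simp
    qed
    have lower: "\<rho> ^ n * v 0 \<le> v n" for n
    proof (induction n)
      case (Suc n)
      have "\<rho> ^ Suc n * v 0 \<le> \<rho> * v n" using Suc \<rho> by (simp add: mult.assoc)
      then show ?case using grow[of n] by linarith
    qed simp
    have "eventually (\<lambda>n. C * (2 * real n + D)\<^sup>2 < \<rho> ^ n * v 0) sequentially"
      using \<rho> v0 by real_asymp
    then obtain n where "C * (2 * real n + D)\<^sup>2 < \<rho> ^ n * v 0"
      by (meson eventually_sequentially order_refl)
    moreover have "v n \<le> C * (2 * real n + D)\<^sup>2"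
      using growth[of "2 * n"] by (simp add: v_def)
    ultimately show False using lower[of n] by linarith
  qed
  have "(u 1)\<^sup>2 \<le> v 0 * v 1" using cs[of 0 1] by (simp add: v_def)
  also have "\<dots> \<le> v 0 * v 0" using v_le nonneg[of 0] by (intro mult_left_mono) (auto simp: v_def)
  also have "\<dots> = (u 0)\<^sup>2" by (simp add: v_def power2_eq_square)
  finally show ?thesis using nonneg[of 0] by (simp add: abs_le_square_iff[symmetric])
qed

lemma discriminant_nonpos:
  fixes a b c :: real
  assumes "\<And>s t. 0 \<le> s\<^sup>2 * a + 2 * s * t * b + t\<^sup>2 * c"
  shows "b\<^sup>2 \<le> a * c"
proof (cases "c = 0")
  case True
  have "b = 0"
  proof (rule ccontr)
    assume "b \<noteq> 0"
    then show False using assms[of 1 "- (a + 1) / (2 * b)"] True by (simp add: field_simps)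
  qed
  then show ?thesis using True by simp
next
  case False
  then have "0 < c" using assms[of 0 1] by simp
  moreover have "0 \<le> c * (a * c - b\<^sup>2)"
    using assms[of c "- b"] by (simp add: power2_eq_square algebra_simps)
  ultimately show ?thesis by (simp add: zero_le_mult_iff)
qed

context regular_tree_graph
begin

lemma nbr_avg_const': "nbr_avg (\<lambda>_. c) = (\<lambda>_. c)"
  by (intro ext nbr_avg_const)

text \<open>A list of weights and vertices stands for a finitely supported signed measure; a vertex
  may occur several times. This matches the indexed sums in the definition of negative type,
  and \<open>smear\<close> is the adjoint of the neighbour average.\<close>

definition pairing :: "(real \<times> 'v) list \<Rightarrow> ('v \<Rightarrow> real) \<Rightarrow> real" where
  "pairing xs f = (\<Sum>(a, x)\<leftarrow>xs. a * f x)"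

lemma pairing_Nil [simp]: "pairing [] f = 0"
  and pairing_Cons [simp]: "pairing ((a, x) # xs) f = a * f x + pairing xs f"
  and pairing_append [simp]: "pairing (xs @ ys) f = pairing xs f + pairing ys f"
  by (simp_all add: pairing_def)

lemma pairing_add: "pairing xs (\<lambda>x. f x + g x) = pairing xs f + pairing xs g"
  by (induction xs) (auto simp: algebra_simps)

lemma pairing_mult: "pairing xs (\<lambda>x. c * f x) = c * pairing xs f"
  by (induction xs) (auto simp: algebra_simps)

lemma pairing_zero: "pairing xs (\<lambda>x. 0) = 0"
  by (induction xs) auto

lemma pairing_const: "pairing xs (\<lambda>x. c) = c * pairing xs (\<lambda>_. 1)"
  using pairing_mult[of xs c "\<lambda>_. 1"] by simp

lemma pairing_nth: "pairing xs f = (\<Sum>i<length xs. fst (xs ! i) * f (snd (xs ! i)))"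
  by (simp add: pairing_def sum_list_sum_nth atLeast0LessThan case_prod_beta)

definition scale :: "real \<Rightarrow> (real \<times> 'v) list \<Rightarrow> (real \<times> 'v) list" where
  "scale c xs = map (\<lambda>(a, x). (c * a, x)) xs"

lemma pairing_scale [simp]: "pairing (scale c xs) f = c * pairing xs f"
  by (induction xs) (auto simp: scale_def algebra_simps)

definition nbr_list :: "'v \<Rightarrow> 'v list" where
  "nbr_list x = (SOME ys. set ys = nbrs x \<and> distinct ys)"

lemma nbr_list: "set (nbr_list x) = nbrs x" "distinct (nbr_list x)"
  using someI_ex[OF finite_distinct_list[OF finite_nbrs[of x]]] unfolding nbr_list_def by auto

definition smear :: "(real \<times> 'v) list \<Rightarrow> (real \<times> 'v) list" where
  "smear xs = concat (map (\<lambda>(a, x). map (\<lambda>y. (a / (real q + 1), y)) (nbr_list x)) xs)"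

lemma pairing_smear [simp]: "pairing (smear xs) f = pairing xs (nbr_avg f)"
proof (induction xs)
  case (Cons p xs)
  obtain a x where p: "p = (a, x)" by (cases p)
  have "pairing (map (\<lambda>y. (a / (real q + 1), y)) ys) f = a / (real q + 1) * sum_list (map f ys)" for ys
    by (induction ys) (auto simp: algebra_simps)
  then have "pairing (map (\<lambda>y. (a / (real q + 1), y)) (nbr_list x)) f = a * nbr_avg f x"
    using nbr_list[of x] by (simp add: nbr_avg_def sum_list_distinct_conv_sum_set)
  then show ?case using Cons p by (simp add: smear_def)
qed (simp add: smear_def)

definition kernel_form :: "(nat \<Rightarrow> real) \<Rightarrow> (real \<times> 'v) list \<Rightarrow> (real \<times> 'v) list \<Rightarrow> real" where
  "kernel_form \<phi> xs ys = pairing xs (\<lambda>x. pairing ys (\<lambda>y. \<phi> (d x y)))"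

lemma kernel_form_append:
  "kernel_form \<phi> (xs @ xs') ys = kernel_form \<phi> xs ys + kernel_form \<phi> xs' ys"
  "kernel_form \<phi> xs (ys @ ys') = kernel_form \<phi> xs ys + kernel_form \<phi> xs ys'"
  by (simp_all add: kernel_form_def pairing_add)

lemma kernel_form_scale:
  "kernel_form \<phi> (scale c xs) ys = c * kernel_form \<phi> xs ys"
  "kernel_form \<phi> xs (scale c ys) = c * kernel_form \<phi> xs ys"
  by (simp_all add: kernel_form_def pairing_mult)

lemma kernel_form_sym: "kernel_form \<phi> xs ys = kernel_form \<phi> ys xs"
proof (induction xs)
  case Nil
  then show ?case by (simp add: kernel_form_def pairing_zero)
next
  case (Cons p xs)
  obtain a x where p: "p = (a, x)" by (cases p)
  have "kernel_form \<phi> ys (p # xs) = pairing ys (\<lambda>y. a * \<phi> (d x y)) + kernel_form \<phi> ys xs"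
    using dist_sym[of x] by (simp add: kernel_form_def p pairing_add)
  then show ?case using Cons by (simp add: kernel_form_def p pairing_mult)
qed

lemma nbr_avg_pairing: "nbr_avg (\<lambda>x. pairing ys (h x)) z = pairing ys (\<lambda>y. nbr_avg (\<lambda>x. h x y) z)"
proof (induction ys)
  case Nil
  then show ?case by (simp add: nbr_avg_def)
next
  case (Cons p ys)
  obtain a x where p: "p = (a, x)" by (cases p)
  show ?case using Cons nbr_avg_scaleR[of a "\<lambda>z. h z x" z] by (simp add: p nbr_avg_add)
qed

text \<open>Symmetry of \<open>d\<close> allows the average to be taken in either variable of the kernel.\<close>

lemma kernel_form_smear: "kernel_form \<phi> (smear xs) ys = kernel_form (radial_avg \<phi>) xs ys"
proof -
  have "nbr_avg (\<lambda>x. \<phi> (d x y)) z = radial_avg \<phi> (d z y)" for y z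
    using nbr_avg_radial[of \<phi> y z] dist_sym[of y] by simp
  then have "nbr_avg (\<lambda>x. pairing ys (\<lambda>y. \<phi> (d x y))) = (\<lambda>x. pairing ys (\<lambda>y. radial_avg \<phi> (d x y)))"
    by (intro ext) (simp add: nbr_avg_pairing)
  then show ?thesis by (simp add: kernel_form_def)
qed

lemma kernel_form_add: "kernel_form (\<lambda>n. \<phi> n + \<phi>' n) xs ys = kernel_form \<phi> xs ys + kernel_form \<phi>' xs ys"
  by (simp add: kernel_form_def pairing_add)

lemma kernel_form_mult: "kernel_form (\<lambda>n. c * \<phi> n) xs ys = c * kernel_form \<phi> xs ys"
  by (simp add: kernel_form_def pairing_mult)

lemma kernel_form_const: "kernel_form (\<lambda>n. c) xs ys = c * pairing xs (\<lambda>_. 1) * pairing ys (\<lambda>_. 1)"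
  unfolding kernel_form_def
  by (subst pairing_const[of ys], subst pairing_const[of xs]) simp

definition negative_kernel :: "(nat \<Rightarrow> real) \<Rightarrow> bool" where
  "negative_kernel \<phi> \<longleftrightarrow> (\<forall>xs. pairing xs (\<lambda>_. 1) = 0 \<longrightarrow> kernel_form \<phi> xs xs \<le> 0)"

lemma pairing_smear_pow: "pairing ((smear ^^ n) xs) (\<lambda>_. 1) = pairing xs (\<lambda>_. 1)"
  by (induction n) (simp_all add: nbr_avg_const')

lemma kernel_form_smear_pow:
  "kernel_form \<phi> ((smear ^^ i) xs) ((smear ^^ j) xs) = kernel_form ((radial_avg ^^ (i + j)) \<phi>) xs xs"
proof -
  have 1: "kernel_form \<phi> ((smear ^^ i) xs) ys = kernel_form ((radial_avg ^^ i) \<phi>) xs ys" for \<phi> xs ys i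
    by (induction i arbitrary: \<phi>) (simp_all add: kernel_form_smear funpow_swap1[of radial_avg])
  show ?thesis
    using 1[of \<phi> i xs "(smear ^^ j) xs"] 1[of "(radial_avg ^^ i) \<phi>" j xs xs]
      kernel_form_sym[of _ xs "(smear ^^ j) xs"]
    by (simp add: funpow_add[symmetric] add.commute flip: comp_apply[of "radial_avg ^^ j"])
qed

lemma radial_avg_pow_bound:
  assumes "\<And>m. \<bar>\<phi> m\<bar> \<le> c * (real m)\<^sup>2" "0 \<le> c"
  shows "\<bar>(radial_avg ^^ n) \<phi> m\<bar> \<le> c * (real m + real n)\<^sup>2"
proof (induction n arbitrary: m)
  case 0
  then show ?case using assms by simp
next
  case (Suc n)
  let ?f = "(radial_avg ^^ n) \<phi>"
  let ?B = "c * (real m + real (Suc n))\<^sup>2"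
  have up: "\<bar>?f (m + 1)\<bar> \<le> ?B" using Suc[of "m + 1"] by (simp add: add_ac)
  show ?case
  proof (cases "m = 0")
    case True
    then have "(radial_avg ^^ Suc n) \<phi> m = ?f (m + 1)" by (simp add: radial_avg_def)
    then show ?thesis using up by simp
  next
    case False
    have "c * (real (m - 1) + real n)\<^sup>2 \<le> ?B"
      using assms(2) by (intro mult_left_mono power_mono) auto
    then have down: "\<bar>?f (m - 1)\<bar> \<le> ?B" using Suc[of "m - 1"] by linarith
    have "\<bar>real q * ?f (m + 1) + ?f (m - 1)\<bar> \<le> real q * \<bar>?f (m + 1)\<bar> + \<bar>?f (m - 1)\<bar>"
      by (simp add: abs_mult order_trans[OF abs_triangle_ineq])
    also have "\<dots> \<le> real q * ?B + ?B" using up down by (intro add_mono mult_left_mono) auto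
    finally have "\<bar>real q * ?f (m + 1) + ?f (m - 1)\<bar> \<le> ?B * (real q + 1)" by (simp add: algebra_simps)
    then have "\<bar>real q * ?f (m + 1) + ?f (m - 1)\<bar> / (real q + 1) \<le> ?B"
      by (subst pos_divide_le_eq) auto
    then show ?thesis using False by (simp add: radial_avg_def[of ?f] abs_divide)
  qed
qed

lemma pairing_bound:
  assumes "\<And>a x. (a, x) \<in> set xs \<Longrightarrow> \<bar>f x\<bar> \<le> B"
  shows "\<bar>pairing xs f\<bar> \<le> (\<Sum>(a, x)\<leftarrow>xs. \<bar>a\<bar>) * B"
  using assms
proof (induction xs)
  case (Cons p xs)
  obtain a x where p: "p = (a, x)" by (cases p)
  have "\<bar>f x\<bar> \<le> B" using Cons.prems[of a x] p by simp
  then have "\<bar>a * f x\<bar> \<le> \<bar>a\<bar> * B" by (simp add: abs_mult mult_left_mono)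
  moreover have "\<bar>pairing xs f\<bar> \<le> (\<Sum>(a, x)\<leftarrow>xs. \<bar>a\<bar>) * B" using Cons by auto
  ultimately show ?case using p abs_triangle_ineq[of "a * f x" "pairing xs f"]
    by (simp add: algebra_simps)
qed simp

lemma kernel_form_growth:
  assumes "\<And>m. \<bar>\<phi> m\<bar> \<le> c * (real m)\<^sup>2" "0 \<le> c"
  shows "\<exists>C D. \<forall>n. \<bar>kernel_form ((radial_avg ^^ n) \<phi>) xs xs\<bar> \<le> C * (real n + D)\<^sup>2"
proof -
  define D where "D = Max ((\<lambda>(p, p'). d (snd p) (snd p')) ` (set xs \<times> set xs))"
  have D: "d x y \<le> D" if "(a, x) \<in> set xs" "(b, y) \<in> set xs" for a b x y
  proof -
    have "(\<lambda>(p, p'). d (snd p) (snd p')) ((a, x), (b, y)) \<in> (\<lambda>(p, p'). d (snd p) (snd p')) ` (set xs \<times> set xs)"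
      by (rule imageI) (use that in simp)
    then show ?thesis unfolding D_def by (intro Max_ge) simp_all
  qed
  define A where "A = (\<Sum>(a, x)\<leftarrow>xs. \<bar>a\<bar>)"
  have A: "0 \<le> A" unfolding A_def by (rule sum_list_nonneg) auto
  have "\<bar>kernel_form ((radial_avg ^^ n) \<phi>) xs xs\<bar> \<le> (A * A * c) * (real n + real D)\<^sup>2" for n
  proof -
    have "\<bar>(radial_avg ^^ n) \<phi> (d x y)\<bar> \<le> c * (real n + real D)\<^sup>2"
      if "(a, x) \<in> set xs" "(b, y) \<in> set xs" for a b x y
    proof -
      have "\<bar>(radial_avg ^^ n) \<phi> (d x y)\<bar> \<le> c * (real (d x y) + real n)\<^sup>2"
        by (rule radial_avg_pow_bound) (use assms in auto)
      also have "\<dots> \<le> c * (real n + real D)\<^sup>2"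
        using D[OF that] assms(2) by (intro mult_left_mono power_mono) auto
      finally show ?thesis .
    qed
    then have "\<bar>pairing xs (\<lambda>y. (radial_avg ^^ n) \<phi> (d x y))\<bar> \<le> A * (c * (real n + real D)\<^sup>2)"
      if "(a, x) \<in> set xs" for a x
      unfolding A_def using that by (intro pairing_bound) blast
    then have "\<bar>kernel_form ((radial_avg ^^ n) \<phi>) xs xs\<bar> \<le> A * (A * (c * (real n + real D)\<^sup>2))"
      unfolding kernel_form_def by (subst A_def, intro pairing_bound) blast
    then show ?thesis by (simp add: mult.assoc)
  qed
  then show ?thesis by blast
qed

text \<open>The average is a contraction for the semi-inner product given by the kernel. The
  quadratic form of \<open>s M\<^sup>i \<alpha> + t M\<^sup>j \<alpha>\<close> has the coefficients \<open>u (2 i)\<close>,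
  \<open>u (i + j)\<close> and \<open>u (2 j)\<close> because \<open>M\<close> is symmetric.\<close>

lemma negative_kernel_radial_avg:
  assumes neg: "negative_kernel \<phi>"
    and growth: "\<And>m. \<bar>\<phi> m\<bar> \<le> c * (real m)\<^sup>2" "0 \<le> c"
    and xs: "pairing xs (\<lambda>_. 1) = 0"
  shows "\<bar>kernel_form (radial_avg \<phi>) xs xs\<bar> \<le> - kernel_form \<phi> xs xs"
proof -
  define u where "u n = - kernel_form ((radial_avg ^^ n) \<phi>) xs xs" for n
  have quad: "0 \<le> s\<^sup>2 * u (2 * i) + 2 * s * t * u (i + j) + t\<^sup>2 * u (2 * j)" for s t i j
  proof -
    define zs where "zs = scale s ((smear ^^ i) xs) @ scale t ((smear ^^ j) xs)"
    have "pairing zs (\<lambda>_. 1) = 0" by (simp add: zs_def pairing_smear_pow xs)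
    then have "kernel_form \<phi> zs zs \<le> 0" using neg unfolding negative_kernel_def by blast
    moreover have "kernel_form \<phi> zs zs = - (s\<^sup>2 * u (2 * i) + 2 * s * t * u (i + j) + t\<^sup>2 * u (2 * j))"
    proof -
      have E: "kernel_form \<phi> ((smear ^^ a) xs) ((smear ^^ b) xs) = - u (a + b)" for a b
        by (simp add: kernel_form_smear_pow u_def)
      have c: "u (j + i) = u (i + j)" by (simp only: add.commute)
      show ?thesis
        unfolding zs_def kernel_form_append kernel_form_scale E c mult_2 power2_eq_square
        by (simp only: algebra_simps)
    qed
    ultimately show ?thesis by simp
  qed
  obtain C D where CD: "\<And>n. \<bar>u n\<bar> \<le> C * (real n + D)\<^sup>2"
    using kernel_form_growth[OF growth, of xs] unfolding u_def by auto
  have "\<bar>u 1\<bar> \<le> u 0"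
  proof (rule polynomial_growth_log_convex)
    show "(u (i + j))\<^sup>2 \<le> u (2 * i) * u (2 * j)" for i j by (rule discriminant_nonpos[OF quad])
    show "0 \<le> u (2 * i)" for i using quad[of 1 i 0 0] by simp
  qed (rule CD)
  then show ?thesis by (simp add: u_def)
qed

text \<open>The masses \<open>(M - 1) \<delta>\<^sub>x\<close> have total mass 0 and a norm that does not depend on \<open>x\<close>.
  As \<open>M\<close> acts by the scalar \<open>l\<close>, differences of point masses are bounded by them up to the
  factor \<open>l - 1\<close>; concretely, the inequality is negativity of the form at
  \<open>(M - 1) (\<delta>\<^sub>x + \<delta>\<^sub>y)\<close> with \<open>d x y = n\<close>.\<close>

lemma eigen_kernel_bounded:
  assumes neg: "negative_kernel \<phi>" and eig: "\<And>n. radial_avg \<phi> n = l * \<phi> n + \<phi> 1"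
    and "\<phi> 0 = 0"
  shows "(l - 1)\<^sup>2 * \<phi> n \<le> 2 * (1 - l) * \<phi> 1"
proof -
  fix x :: 'v
  obtain y where y: "d x y = n" using vertex_at_distance by blast
  define xs :: "(real \<times> 'v) list" where "xs = [(1, x), (1, y)]"
  define zs where "zs = smear xs @ scale (- 1) xs"
  have m: "pairing xs (\<lambda>_. 1) = 2" by (simp add: xs_def)
  have e1: "kernel_form (radial_avg f) xs xs = l * kernel_form f xs xs + 4 * c"
    if "\<And>n. radial_avg f n = l * f n + c" for f c
  proof -
    have "radial_avg f = (\<lambda>n. l * f n + c)" using that by auto
    then show ?thesis by (simp add: kernel_form_add kernel_form_mult kernel_form_const m)
  qed
  have "radial_avg (radial_avg \<phi>) n = l * radial_avg \<phi> n + \<phi> 1" for n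
  proof -
    have R: "radial_avg \<phi> = (\<lambda>n. l * \<phi> n + \<phi> 1)" using eig by auto
    have "radial_avg (\<lambda>n. l * \<phi> n + \<phi> 1) n = l * radial_avg \<phi> n + \<phi> 1"
      by (simp add: radial_avg_def field_simps)
    then show ?thesis using R by simp
  qed
  then have k2: "kernel_form (radial_avg (radial_avg \<phi>)) xs xs
      = l * kernel_form (radial_avg \<phi>) xs xs + 4 * \<phi> 1" by (rule e1)
  have k1: "kernel_form (radial_avg \<phi>) xs xs = l * kernel_form \<phi> xs xs + 4 * \<phi> 1" using eig by (rule e1)
  have k0: "kernel_form \<phi> xs xs = 2 * \<phi> n"
    using y dist_sym[of x y] \<open>\<phi> 0 = 0\<close> by (simp add: kernel_form_def xs_def)
  have "kernel_form \<phi> zs zs = kernel_form (radial_avg (radial_avg \<phi>)) xs xs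
     - 2 * kernel_form (radial_avg \<phi>) xs xs + kernel_form \<phi> xs xs"
    using kernel_form_sym[of \<phi> xs "smear xs"] kernel_form_sym[of "radial_avg \<phi>" xs "smear xs"]
    by (simp add: zs_def kernel_form_append kernel_form_scale kernel_form_smear)
  moreover have "kernel_form \<phi> zs zs \<le> 0"
    using neg unfolding negative_kernel_def by (simp add: zs_def nbr_avg_const')
  ultimately show ?thesis unfolding k2 k1 k0 by (simp add: power2_eq_square algebra_simps)
qed

text \<open>Both sides solve the same recurrence of order two with the same values at 0 and 1.\<close>

lemma harmonic_kernel_formula:
  assumes eig: "\<And>n. radial_avg \<phi> n = \<phi> n + \<phi> 1" and "\<phi> 0 = 0"
  defines "C \<equiv> (real q + 1) / (real q - 1) * \<phi> 1"
  shows "\<phi> n = C * (real n + 2 * real q / ((real q)\<^sup>2 - 1) * (real q powi (- int n) - 1))"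
proof -
  define F where "F n = C * (real n + 2 * real q / ((real q)\<^sup>2 - 1) * (1 / real q ^ n - 1))" for n
  have q: "real q > 1" "real q \<noteq> 0" using q2 by auto
  have q1: "(real q)\<^sup>2 - 1 = (real q - 1) * (real q + 1)" by (simp add: power2_eq_square algebra_simps)
  have C: "(real q + 1) * \<phi> 1 = (real q - 1) * C" using q by (simp add: C_def)
  have F1: "F 1 = \<phi> 1"
  proof -
    have "2 * real q / ((real q - 1) * (real q + 1)) * (1 / real q - 1) = - 2 / (real q + 1)"
      using q by (simp add: divide_simps)
    then have "F 1 = C * (1 - 2 / (real q + 1))" unfolding F_def q1 by simp
    also have "\<dots> = \<phi> 1" unfolding C_def using q by (simp add: divide_simps)
    finally show ?thesis .
  qed
  have Frec: "real q * F (Suc (Suc n)) = (real q + 1) * F (Suc n) - F n + (real q - 1) * C" for n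
  proof -
    define b x where "b = 2 * real q / ((real q)\<^sup>2 - 1)" and "x = 1 / real q ^ Suc (Suc n)"
    have x: "1 / real q ^ Suc n = real q * x" "1 / real q ^ n = real q * (real q * x)"
      using q by (simp_all add: x_def)
    show ?thesis
      unfolding F_def b_def[symmetric] x x_def[symmetric] by (simp add: algebra_simps)
  qed
  have "\<phi> n = F n \<and> \<phi> (Suc n) = F (Suc n)"
  proof (induction n)
    case 0
    then show ?case using F1 \<open>\<phi> 0 = 0\<close> by (simp add: F_def)
  next
    case (Suc n)
    have "real q * \<phi> (Suc (Suc n)) + \<phi> n = (real q + 1) * (\<phi> (Suc n) + \<phi> 1)"
      using eig[of "Suc n"] by (simp add: radial_avg_def field_simps)
    then have "real q * \<phi> (Suc (Suc n)) = (real q + 1) * F (Suc n) - F n + (real q + 1) * \<phi> 1"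
      using Suc by (simp add: algebra_simps)
    then have "real q * \<phi> (Suc (Suc n)) = real q * F (Suc (Suc n))"
      using Frec[of n] C by linarith
    then show ?case using Suc q by simp
  qed
  moreover have "real q powi (- int n) = 1 / real q ^ n"
    by (simp add: power_int_minus field_simps)
  ultimately show ?thesis by (simp add: F_def)
qed

end

section \<open>Radial functions in the cone and purity\<close>

context boundary_transitive_group
begin

abbreviation grp :: "('v \<Rightarrow> 'v) monoid" where "grp \<equiv> (Aut adj)\<lparr>carrier := G\<rparr>"

abbreviation grp_top :: "('v \<Rightarrow> 'v) topology" where "grp_top \<equiv> subtopology (Aut_topology adj) G"

abbreviation len :: "('v \<Rightarrow> 'v) \<Rightarrow> nat" where "len g \<equiv> d (g x0) x0"

lemma grp_simps [simp]:
  "carrier grp = G" "f \<otimes>\<^bsub>grp\<^esub> g = f \<circ> g" "\<one>\<^bsub>grp\<^esub> = id" "f \<otimes>\<^bsub>Aut adj\<^esub> g = f \<circ> g"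
  by (simp_all add: Aut_def)

lemma grp_inv: "g \<in> G \<Longrightarrow> inv\<^bsub>grp\<^esub> g = finv g"
  using m_inv_Aut G_bij G_inv by blast

lemma len_diff: "g \<in> G \<Longrightarrow> h \<in> G \<Longrightarrow> len (finv g \<circ> h) = d (g x0) (h x0)"
  using G_dist[of g "finv g (h x0)" x0] dist_sym by simp

lemma CL_D:
  fixes n :: nat and \<psi> :: "('v \<Rightarrow> 'v) \<Rightarrow> real"
  assumes "\<psi> \<in> CL grp grp_top"
  shows "\<psi> id = 0" "g \<in> G \<Longrightarrow> \<psi> (finv g) = \<psi> g"
    "(\<And>i. i < n \<Longrightarrow> h i \<in> G) \<Longrightarrow> (\<Sum>i<n. \<alpha> i) = 0 \<Longrightarrow>
        (\<Sum>i<n. \<Sum>j<n. \<alpha> i * \<alpha> j * \<psi> (finv (h i) \<circ> h j)) \<le> 0"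
proof -
  note C = assms[unfolded CL_def, simplified mem_Collect_eq]
  show "\<psi> id = 0" "g \<in> G \<Longrightarrow> \<psi> (finv g) = \<psi> g" using C grp_inv by auto
  assume a: "\<And>i. i < n \<Longrightarrow> h i \<in> G" "(\<Sum>i<n. \<alpha> i) = 0"
  then have "(\<Sum>i<n. \<Sum>j<n. \<alpha> i * \<alpha> j * \<psi> (inv\<^bsub>grp\<^esub> h i \<otimes>\<^bsub>grp\<^esub> h j)) \<le> 0"
  proof -
    from C[THEN conjunct2, THEN conjunct2, THEN conjunct2, rule_format, of n h \<alpha>] show ?thesis using a by simp
  qed
  also have "(\<Sum>i<n. \<Sum>j<n. \<alpha> i * \<alpha> j * \<psi> (inv\<^bsub>grp\<^esub> h i \<otimes>\<^bsub>grp\<^esub> h j))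
     = (\<Sum>i<n. \<Sum>j<n. \<alpha> i * \<alpha> j * \<psi> (finv (h i) \<circ> h j))"
    by (intro sum.cong refl) (use a grp_inv in auto)
  finally show "(\<Sum>i<n. \<Sum>j<n. \<alpha> i * \<alpha> j * \<psi> (finv (h i) \<circ> h j)) \<le> 0" .
qed

lemma finv_comp: "g \<in> G \<Longrightarrow> h \<in> G \<Longrightarrow> finv (g \<circ> h) = finv h \<circ> finv g"
  using o_inv_distrib G_bij by blast

lemma finv_finv: "g \<in> G \<Longrightarrow> finv (finv g) = g"
  using inv_inv_eq G_bij by blast

lemma CL_nonneg:
  assumes "\<psi> \<in> CL grp grp_top" "g \<in> G" shows "0 \<le> \<psi> g"
proof -
  define h where "h i = (if i = 0 then id else g)" for i :: nat
  define \<alpha> :: "nat \<Rightarrow> real" where "\<alpha> i = (if i = 0 then 1 else - 1)" for i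
  have "(\<Sum>i<2. \<Sum>j<2. \<alpha> i * \<alpha> j * \<psi> (finv (h i) \<circ> h j)) \<le> 0"
    by (rule CL_D(3)[OF assms(1)]) (use assms G_id in \<open>auto simp: h_def \<alpha>_def numeral_2_eq_2\<close>)
  moreover have "finv g \<circ> g = id" using assms(2) by auto
  ultimately show ?thesis
    using CL_D(1,2)[OF assms(1)] assms(2) by (simp add: h_def \<alpha>_def numeral_2_eq_2)
qed

text \<open>The triangle inequality for the square root of \<open>\<psi>\<close>, in a form with squares only: it is
  the negativity condition for the points \<open>finv g\<close>, \<open>id\<close>, \<open>h\<close> with weights \<open>1\<close>,
  \<open>- (1 + t)\<close>, \<open>t\<close>.\<close>

lemma CL_three_points:
  assumes "\<psi> \<in> CL grp grp_top" "g \<in> G" "h \<in> G" "0 < t"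
  shows "\<psi> (g \<circ> h) \<le> (1 + 1 / t) * \<psi> g + (1 + t) * \<psi> h"
proof -
  define k where "k i = (if i = 0 then finv g else if i = 1 then id else h)" for i :: nat
  define \<alpha> where "\<alpha> i = (if i = 0 then 1 else if i = 1 then - (1 + t) else t)" for i :: nat
  have "(\<Sum>i<3. \<Sum>j<3. \<alpha> i * \<alpha> j * \<psi> (finv (k i) \<circ> k j)) \<le> 0"
    by (rule CL_D(3)[OF assms(1)]) (use assms G_id G_inv in \<open>auto simp: k_def \<alpha>_def numeral_3_eq_3\<close>)
  moreover have "finv h \<circ> h = id" "g \<circ> finv g = id" using assms by auto
  moreover have "\<psi> (finv h \<circ> finv g) = \<psi> (g \<circ> h)"
    using CL_D(2)[OF assms(1)] assms finv_comp G_comp by metis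
  ultimately have "2 * (t * \<psi> (g \<circ> h)) \<le> 2 * ((1 + t) * \<psi> g + t * (1 + t) * \<psi> h)"
    using CL_D(1,2)[OF assms(1)] assms
    by (simp add: k_def \<alpha>_def numeral_3_eq_3 finv_finv algebra_simps)
  then have "t * \<psi> (g \<circ> h) \<le> t * ((1 + 1 / t) * \<psi> g + (1 + t) * \<psi> h)"
    using assms(4) by (simp add: algebra_simps)
  then show ?thesis using assms(4) by simp
qed

text \<open>Let \<open>t\<close> tend to infinity in the inequality for three points.\<close>

lemma CL_stabiliser_invariant:
  assumes "\<psi> \<in> CL grp grp_top" "g \<in> G" "k \<in> G" "\<psi> k = 0"
  shows "\<psi> (g \<circ> k) = \<psi> g"
proof -
  have le: "\<psi> (g \<circ> k) \<le> \<psi> g" if "g \<in> G" "k \<in> G" "\<psi> k = 0" for g k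
  proof (rule field_le_epsilon)
    fix e :: real assume e: "0 < e"
    define t where "t = \<psi> g / e + 1"
    have g0: "0 \<le> \<psi> g" using CL_nonneg assms(1) that by blast
    have t: "0 < t" using g0 e by (simp add: t_def add_nonneg_pos)
    have "\<psi> g \<le> e * t" using e by (simp add: t_def algebra_simps)
    then have "\<psi> g / t \<le> e" using t by (simp add: pos_divide_le_eq)
    then show "\<psi> (g \<circ> k) \<le> \<psi> g + e"
      using CL_three_points[OF assms(1) that(1,2) t] that(3) by (simp add: algebra_simps)
  qed
  have "\<psi> (finv k) = 0" using CL_D(2)[OF assms(1)] assms by simp
  then have "\<psi> ((g \<circ> k) \<circ> finv k) \<le> \<psi> (g \<circ> k)" using assms G_comp G_inv by (intro le) auto
  moreover have "(g \<circ> k) \<circ> finv k = g" using assms(3) by auto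
  ultimately show ?thesis using le[OF assms(2-4)] by simp
qed

lemma len_surj: "\<exists>g\<in>G. len g = n"
  using vertex_at_distance[of x0 n] vertex_trans_obtain[of x0] dist_sym by metis

text \<open>Transitivity on spheres says that elements of equal length lie in the same double coset of
  the stabiliser, on which \<open>\<psi>\<close> is constant.\<close>

lemma CL_radial:
  assumes "\<psi> \<in> CL grp grp_top" "\<forall>g\<in>vertex_stabiliser G x0. \<psi> g = 0"
  shows "\<exists>\<phi>. \<forall>g\<in>G. \<psi> g = \<phi> (len g)"
proof -
  have K0: "\<psi> k = 0" if "k \<in> G" "k x0 = x0" for k
    using assms(2) that unfolding vertex_stabiliser_def by blast
  have eq: "\<psi> g = \<psi> h" if gh: "g \<in> G" "h \<in> G" "len g = len h" for g h
  proof -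
    have "d x0 (g x0) = d x0 (h x0)" using gh(3) dist_sym by simp
    then obtain k where k: "k \<in> G" "k x0 = x0" "k (g x0) = h x0" using sphere_transitive by blast
    define k' where "k' = finv (k \<circ> g) \<circ> h"
    have kg: "k \<circ> g \<in> G" using k gh G_comp by blast
    have k': "k' \<in> G" "k' x0 = x0"
      using kg gh G_comp G_inv k inv_apply[OF kg, of x0] unfolding k'_def by auto
    have h: "h = k \<circ> (g \<circ> k')"
    proof
      fix x show "h x = (k \<circ> (g \<circ> k')) x" using apply_inv[OF kg, of "h x"] by (simp add: k'_def)
    qed
    have gk': "g \<circ> k' \<in> G" "finv (g \<circ> k') \<in> G" "finv k \<in> G" "finv k x0 = x0"
      using gh k' G_comp G_inv k inv_apply[OF k(1), of x0] by auto
    have "\<psi> h = \<psi> (finv (g \<circ> k') \<circ> finv k)"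
      using CL_D(2)[OF assms(1), of h] gh h finv_comp[OF k(1) gk'(1)] by simp
    also have "\<dots> = \<psi> (finv (g \<circ> k'))"
      using CL_stabiliser_invariant[OF assms(1) gk'(2,3)] K0 gk' by blast
    also have "\<dots> = \<psi> (g \<circ> k')" using CL_D(2)[OF assms(1)] gk' by blast
    also have "\<dots> = \<psi> g" using CL_stabiliser_invariant[OF assms(1) gh(1) k'(1)] K0 k' by blast
    finally show ?thesis ..
  qed
  define \<phi> where "\<phi> n = \<psi> (SOME g. g \<in> G \<and> len g = n)" for n
  have "\<psi> g = \<phi> (len g)" if "g \<in> G" for g
  proof -
    define h where "h = (SOME h. h \<in> G \<and> len h = len g)"
    have "\<exists>h. h \<in> G \<and> len h = len g" using that by blast
    from someI_ex[OF this] have "h \<in> G" "len h = len g" unfolding h_def by auto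
    then show ?thesis using eq[OF that, of h] unfolding \<phi>_def h_def by simp
  qed
  then show ?thesis by blast
qed

lemma CL_radial_negative_kernel:
  assumes "\<psi> \<in> CL grp grp_top" "\<forall>g\<in>G. \<psi> g = \<phi> (len g)"
  shows "negative_kernel \<phi>"
  unfolding negative_kernel_def
proof (intro allI impI)
  fix xs assume m: "pairing xs (\<lambda>_. 1) = 0"
  have "\<forall>x. \<exists>g. g \<in> G \<and> g x0 = x" using vertex_trans_obtain by metis
  then obtain \<gamma> where \<gamma>: "\<And>x. \<gamma> x \<in> G" "\<And>x. \<gamma> x x0 = x" by metis
  define h where "h i = \<gamma> (snd (xs ! i))" for i
  define \<alpha> where "\<alpha> i = fst (xs ! i)" for i
  have "(\<Sum>i<length xs. \<Sum>j<length xs. \<alpha> i * \<alpha> j * \<psi> (finv (h i) \<circ> h j)) \<le> 0"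
    by (rule CL_D(3)[OF assms(1)]) (use m \<gamma> in \<open>auto simp: h_def \<alpha>_def pairing_nth\<close>)
  moreover have "\<psi> (finv (h i) \<circ> h j) = \<phi> (d (snd (xs ! i)) (snd (xs ! j)))" for i j
  proof -
    have "h i \<in> G" "h j \<in> G" using \<gamma> by (auto simp: h_def)
    then show ?thesis
      using assms(2) len_diff[of "h i" "h j"] G_comp[OF G_inv] \<gamma>(2) by (simp only: h_def)
  qed
  ultimately show "kernel_form \<phi> xs xs \<le> 0"
    by (simp add: kernel_form_def pairing_nth \<alpha>_def sum_distrib_left mult.assoc)
qed

lemma continuous_orbit: "continuous_map grp_top euclideanreal (\<lambda>g. \<phi> (g x0))"
proof -
  have "continuous_map (product_topology (\<lambda>_. discrete_topology UNIV) UNIV) (discrete_topology UNIV) (\<lambda>g :: 'v \<Rightarrow> 'v. g x0)"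
    using continuous_map_product_projection[of x0 UNIV "\<lambda>_. discrete_topology UNIV"] by simp
  then have "continuous_map grp_top (discrete_topology UNIV) (\<lambda>g. g x0)"
    unfolding Aut_topology_def by (intro continuous_map_from_subtopology)
  from continuous_map_compose[OF this, of euclideanreal \<phi>] show ?thesis by (simp add: o_def)
qed

lemma negative_kernel_CL:
  assumes "negative_kernel \<phi>" "\<phi> 0 = 0"
  shows "(\<lambda>g. \<phi> (len g)) \<in> CL grp grp_top"
  unfolding CL_def
proof (intro CollectI conjI allI impI ballI)
  show "continuous_map grp_top euclideanreal (\<lambda>g. \<phi> (len g))" by (rule continuous_orbit)
  show "\<phi> (len \<one>\<^bsub>grp\<^esub>) = 0" using assms(2) by simp
  show "\<phi> (len (inv\<^bsub>grp\<^esub> g)) = \<phi> (len g)" if "g \<in> carrier grp" for g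
    using that grp_inv[of g] G_dist[of g "finv g x0" x0] dist_sym[of x0] by simp
next
  fix n :: nat and g :: "nat \<Rightarrow> 'v \<Rightarrow> 'v" and \<alpha> :: "nat \<Rightarrow> real"
  assume a: "\<forall>i<n. g i \<in> carrier grp" "(\<Sum>i<n. \<alpha> i) = 0"
  define xs where "xs = map (\<lambda>i. (\<alpha> i, g i x0)) [0..<n]"
  have P: "pairing xs f = (\<Sum>i<n. \<alpha> i * f (g i x0))" for f
    unfolding pairing_nth by (rule sum.cong) (auto simp: xs_def)
  have "kernel_form \<phi> xs xs \<le> 0" using assms(1) a unfolding negative_kernel_def by (simp add: P)
  then have "(\<Sum>i<n. \<Sum>j<n. \<alpha> i * \<alpha> j * \<phi> (d (g i x0) (g j x0))) \<le> 0"
    by (simp add: kernel_form_def P sum_distrib_left mult.assoc)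
  also have "(\<Sum>i<n. \<Sum>j<n. \<alpha> i * \<alpha> j * \<phi> (d (g i x0) (g j x0)))
     = (\<Sum>i<n. \<Sum>j<n. \<alpha> i * \<alpha> j * \<phi> (len (inv\<^bsub>grp\<^esub> g i \<otimes>\<^bsub>grp\<^esub> g j)))"
  proof (intro sum.cong refl)
    fix i j assume "i \<in> {..<n}" "j \<in> {..<n}"
    then have "g i \<in> G" "g j \<in> G" using a by auto
    then show "\<alpha> i * \<alpha> j * \<phi> (d (g i x0) (g j x0)) = \<alpha> i * \<alpha> j * \<phi> (len (inv\<^bsub>grp\<^esub> g i \<otimes>\<^bsub>grp\<^esub> g j))"
      using len_diff[of "g i" "g j"] grp_inv[of "g i"] by (simp del: comp_apply)
  qed
  finally show "(\<Sum>i<n. \<Sum>j<n. \<alpha> i * \<alpha> j * \<phi> (len (inv\<^bsub>grp\<^esub> g i \<otimes>\<^bsub>grp\<^esub> g j))) \<le> 0" .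
qed

text \<open>With \<open>t = n\<close> the inequality for three points gives
  \<open>\<phi> (n + 1) \<le> (1 + 1 / n) \<phi> n + (1 + n) \<phi> 1\<close>, which is an equality for
  \<open>n\<^sup>2 \<phi> 1\<close>.\<close>

lemma CL_radial_growth:
  assumes "\<psi> \<in> CL grp grp_top" "\<forall>g\<in>G. \<psi> g = \<phi> (len g)"
  shows "\<phi> n \<le> (real n)\<^sup>2 * \<phi> 1"
proof (induction n)
  case 0
  have "\<psi> id = \<phi> 0" using assms(2) G_id by auto
  then show ?case using CL_D(1)[OF assms(1)] by simp
next
  case (Suc n)
  show ?case
  proof (cases "n = 0")
    case False
    obtain y where y: "d x0 y = Suc n" using vertex_at_distance by blast
    obtain z where z: "adj y z" "d x0 z = n" using dist_Suc_obtain[OF y] by blast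
    obtain g f where g: "g \<in> G" "g x0 = z" and f: "f \<in> G" "f x0 = y" using vertex_trans_obtain by metis
    define h where "h = finv g \<circ> f"
    have h: "h \<in> G" using g f G_comp G_inv by (simp add: h_def)
    have "len h = d z y" unfolding h_def len_diff[OF g(1) f(1)] using g f by simp
    then have lh: "len h = 1" using z(1) dist_1[of z y] adj_sym[of y z] by simp
    have gh: "g \<circ> h = f" using g by (auto simp: h_def)
    have "len g = n" "len f = Suc n" using g f y z dist_sym by auto
    then have "\<phi> (Suc n) \<le> (1 + 1 / real n) * \<phi> n + (1 + real n) * \<phi> 1"
      using CL_three_points[OF assms(1) g(1) h, of "real n"] False assms(2) g f h lh gh by simp
    also have "\<dots> \<le> (1 + 1 / real n) * ((real n)\<^sup>2 * \<phi> 1) + (1 + real n) * \<phi> 1"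
      using Suc by (intro add_right_mono mult_left_mono) auto
    also have "\<dots> = (real (Suc n))\<^sup>2 * \<phi> 1" using False by (simp add: field_simps power2_eq_square)
    finally show ?thesis .
  qed simp
qed

text \<open>The functions \<open>f 1\<close> and \<open>f (- 1)\<close> of the proof correspond to the positive operators
  \<open>(1 + M) / 2\<close> and \<open>(1 - M) / 2\<close>; the constant \<open>\<phi> 1\<close> is subtracted to make them
  vanish at 0 and does not change the form on masses of total mass 0.\<close>

theorem pure_radial_eigenfunction:
  assumes "pure_in_CL grp grp_top \<psi>" "\<forall>g\<in>vertex_stabiliser G x0. \<psi> g = 0"
  shows "\<exists>\<phi> l. (\<forall>g\<in>G. \<psi> g = \<phi> (len g)) \<and> \<phi> 0 = 0 \<and> 0 < \<phi> 1 \<and> (\<forall>n. 0 \<le> \<phi> n) \<and> negative_kernel \<phi> \<and>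
     (\<forall>n. radial_avg \<phi> n = l * \<phi> n + \<phi> 1)"
proof -
  have \<psi>: "\<psi> \<in> CL grp grp_top" using assms(1) unfolding pure_in_CL_def by blast
  obtain \<phi> where \<phi>: "\<forall>g\<in>G. \<psi> g = \<phi> (len g)" using CL_radial[OF \<psi> assms(2)] by blast
  have neg: "negative_kernel \<phi>" by (rule CL_radial_negative_kernel[OF \<psi> \<phi>])
  have \<phi>0: "\<phi> 0 = 0" using \<phi> G_id CL_D(1)[OF \<psi>] by force
  have nonneg: "0 \<le> \<phi> n" for n using len_surj[of n] CL_nonneg[OF \<psi>] \<phi> by metis
  have growth: "\<phi> n \<le> (real n)\<^sup>2 * \<phi> 1" for n by (rule CL_radial_growth[OF \<psi> \<phi>])
  have bound: "\<bar>kernel_form (radial_avg \<phi>) xs xs\<bar> \<le> - kernel_form \<phi> xs xs"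
    if "pairing xs (\<lambda>_. 1) = 0" for xs
    by (rule negative_kernel_radial_avg[OF neg _ _ that, of "\<phi> 1"])
       (use growth nonneg in \<open>auto simp: mult.commute\<close>)
  have pos: "0 < \<phi> 1"
  proof (rule ccontr)
    assume "\<not> 0 < \<phi> 1"
    then have "\<phi> 1 = 0" using nonneg[of 1] by simp
    then have "\<phi> n = 0" for n using growth[of n] nonneg[of n] by simp
    then show False using assms(1) \<phi> unfolding pure_in_CL_def by simp
  qed
  define f where "f e n = (\<phi> n + e * (radial_avg \<phi> n - \<phi> 1)) / 2" for e n
  have f_CL: "(\<lambda>g. f e (len g)) \<in> CL grp grp_top" if "e = 1 \<or> e = - 1" for e
  proof (rule negative_kernel_CL)
    show "f e 0 = 0" by (simp add: f_def \<phi>0 radial_avg_def)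
    have "kernel_form (f e) xs xs \<le> 0" if m: "pairing xs (\<lambda>_. 1) = 0" for xs
    proof -
      have "f e = (\<lambda>n. (1 / 2) * \<phi> n + ((e / 2) * radial_avg \<phi> n + (- e * \<phi> 1 / 2)))"
        by (auto simp: f_def field_simps)
      then have "kernel_form (f e) xs xs
          = (1 / 2) * kernel_form \<phi> xs xs + (e / 2) * kernel_form (radial_avg \<phi>) xs xs"
        by (simp only: kernel_form_add kernel_form_mult kernel_form_const m)
      then show ?thesis using bound[OF m] \<open>e = 1 \<or> e = - 1\<close> by auto
    qed
    then show "negative_kernel (f e)" unfolding negative_kernel_def by blast
  qed
  have split: "\<forall>g\<in>carrier grp. \<psi> g = f 1 (len g) + f (- 1) (len g)"
    using \<phi> by (simp add: f_def field_simps)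
  have "\<forall>\<psi>\<^sub>1\<in>CL grp grp_top. \<forall>\<psi>\<^sub>2\<in>CL grp grp_top. (\<forall>g\<in>carrier grp. \<psi> g = \<psi>\<^sub>1 g + \<psi>\<^sub>2 g) \<longrightarrow>
        (\<exists>c\<ge>0. \<forall>g\<in>carrier grp. \<psi>\<^sub>1 g = c * \<psi> g)"
    using assms(1) unfolding pure_in_CL_def by blast
  from mp[OF bspec[OF bspec[OF this f_CL[of 1]] f_CL[of "- 1"]] split]
  have "\<exists>c\<ge>0. \<forall>g\<in>carrier grp. f 1 (len g) = c * \<psi> g" by simp
  then obtain c where c: "\<forall>g\<in>G. f 1 (len g) = c * \<psi> g" by auto
  have "radial_avg \<phi> n = (2 * c - 1) * \<phi> n + \<phi> 1" for n
  proof -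
    obtain g where "g \<in> G" "len g = n" using len_surj by blast
    then have "f 1 n = c * \<phi> n" using c \<phi> by auto
    then show ?thesis by (simp add: f_def field_simps)
  qed
  then show ?thesis using \<phi> \<phi>0 pos nonneg neg by blast
qed

end

section \<open>The representation in the non-harmonic case\<close>

text \<open>A minimising sequence for the distance from \<open>v\<close> to \<open>W\<close> is a Cauchy sequence by the
  parallelogram identity, and its limit is the foot of the perpendicular.\<close>

lemma orthogonal_projection_exists:
  fixes W :: "'h::{real_inner, complete_space} set"
  assumes W: "subspace W" "closed W"
  shows "\<exists>p\<in>W. \<forall>w\<in>W. (v - p) \<bullet> w = 0"
proof -
  define I where "I = (INF w\<in>W. (norm (v - w))\<^sup>2)"
  have bdd: "bdd_below ((\<lambda>w. (norm (v - w))\<^sup>2) ` W)" by (rule bdd_belowI2[of _ 0]) simp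
  have W0: "0 \<in> W" using W(1) by (rule subspace_0)
  have I_le: "I \<le> (norm (v - w))\<^sup>2" if "w \<in> W" for w
    unfolding I_def by (rule cINF_lower[OF bdd that])
  have "\<exists>w\<in>W. (norm (v - w))\<^sup>2 < I + 1 / real (Suc n)" for n
  proof -
    have "(INF w\<in>W. (norm (v - w))\<^sup>2) < I + 1 / real (Suc n)" by (simp add: I_def)
    then show ?thesis using cINF_less_iff[OF _ bdd] W0 by blast
  qed
  then obtain p where pW: "\<And>n. p n \<in> W" and p: "\<And>n. (norm (v - p n))\<^sup>2 < I + 1 / real (Suc n)"
    by metis
  have close: "(norm (p m - p n))\<^sup>2 \<le> 2 / real (Suc m) + 2 / real (Suc n)" for m n
  proof -
    define c where "c = (1 / 2) *\<^sub>R (p m + p n)"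
    have "c \<in> W" unfolding c_def using W(1) pW by (intro subspace_scale subspace_add)
    have "(norm (p m - p n))\<^sup>2 = 2 * (norm (v - p m))\<^sup>2 + 2 * (norm (v - p n))\<^sup>2 - 4 * (norm (v - c))\<^sup>2"
      unfolding c_def power2_norm_eq_inner
      by (simp add: inner_diff_left inner_diff_right inner_add_left inner_add_right inner_commute algebra_simps)
    also have "\<dots> \<le> 2 / real (Suc m) + 2 / real (Suc n)"
    proof -
      have "2 / real (Suc k) = 2 * (1 / real (Suc k))" for k by simp
      from this[of m] this[of n] show ?thesis using p[of m] p[of n] I_le[OF \<open>c \<in> W\<close>] by linarith
    qed
    finally show ?thesis .
  qed
  have "Cauchy p"
  proof (rule metric_CauchyI)
    fix e :: real assume e: "0 < e"
    obtain M where M: "4 / e\<^sup>2 < real (Suc M)" using reals_Archimedean2 less_SucI of_nat_less_iff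
      by (metis less_trans of_nat_less_iff lessI)
    have "dist (p m) (p n) < e" if "M \<le> m" "M \<le> n" for m n
    proof -
      have "1 / real (Suc m) \<le> 1 / real (Suc M)" "1 / real (Suc n) \<le> 1 / real (Suc M)"
        using that by (auto simp: frac_le)
      then have "(norm (p m - p n))\<^sup>2 \<le> 4 / real (Suc M)" using close[of m n] by simp
      also have "\<dots> < e\<^sup>2" using M e by (simp add: field_simps)
      finally show ?thesis using e by (simp add: dist_norm power_less_imp_less_base)
    qed
    then show "\<exists>M. \<forall>m\<ge>M. \<forall>n\<ge>M. dist (p m) (p n) < e" by blast
  qed
  then obtain l where l: "p \<longlonglongrightarrow> l" using Cauchy_convergent convergent_def by blast
  have "l \<in> W" using closed_sequentially[OF W(2) _ l] pW by blast
  have "(norm (v - l))\<^sup>2 \<le> I"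
  proof (rule LIMSEQ_le)
    show "(\<lambda>n. (norm (v - p n))\<^sup>2) \<longlonglongrightarrow> (norm (v - l))\<^sup>2" by (intro tendsto_intros l)
    show "(\<lambda>n. I + 1 / real (Suc n)) \<longlonglongrightarrow> I"
      using tendsto_add[OF tendsto_const LIMSEQ_Suc[OF lim_1_over_n], of I] by simp
    show "\<exists>N. \<forall>n\<ge>N. (norm (v - p n))\<^sup>2 \<le> I + 1 / real (Suc n)" using p less_imp_le by blast
  qed
  have "(v - l) \<bullet> w = 0" if w: "w \<in> W" for w
  proof (rule ccontr)
    assume ne: "(v - l) \<bullet> w \<noteq> 0"
    then have "w \<noteq> 0" by auto
    define t where "t = ((v - l) \<bullet> w) / (w \<bullet> w)"
    have "l + t *\<^sub>R w \<in> W" using \<open>l \<in> W\<close> w W(1) by (intro subspace_add subspace_scale)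
    then have "(norm (v - l))\<^sup>2 \<le> (norm ((v - l) - t *\<^sub>R w))\<^sup>2"
      using I_le \<open>(norm (v - l))\<^sup>2 \<le> I\<close> by (metis diff_diff_eq order_trans)
    also have "\<dots> = (norm (v - l))\<^sup>2 - 2 * t * ((v - l) \<bullet> w) + t * (t * (w \<bullet> w))"
    proof -
      have "(norm (y - t *\<^sub>R w))\<^sup>2 = (norm y)\<^sup>2 - 2 * t * (y \<bullet> w) + t * (t * (w \<bullet> w))" for y
        unfolding power2_norm_eq_inner inner_diff_left inner_diff_right inner_scaleR_left
          inner_scaleR_right inner_commute[of w y] by (simp add: algebra_simps)
      then show ?thesis .
    qed
    also have "\<dots> = (norm (v - l))\<^sup>2 - t * ((v - l) \<bullet> w)"
      using \<open>w \<noteq> 0\<close> by (simp add: t_def)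
    finally have "((v - l) \<bullet> w)\<^sup>2 / (w \<bullet> w) \<le> 0" by (simp add: t_def power2_eq_square)
    moreover have "0 < ((v - l) \<bullet> w)\<^sup>2 / (w \<bullet> w)" using ne \<open>w \<noteq> 0\<close> by simp
    ultimately show False by simp
  qed
  then show ?thesis using \<open>l \<in> W\<close> by blast
qed

lemma (in regular_tree_graph) radial_eigenfunction_zero:
  assumes "\<And>n. radial_avg F n = l * F n" "F 0 = 0"
  shows "F n = 0"
proof -
  have "F n = 0 \<and> F (Suc n) = 0"
  proof (induction n)
    case 0
    then show ?case using assms(1)[of 0] assms(2) by (simp add: radial_avg_def)
  next
    case (Suc n)
    then show ?case using assms(1)[of "Suc n"] q2 by (simp add: radial_avg_def)
  qed
  then show ?thesis by simp
qed

locale nonharmonic_GNS = boundary_transitive_group adj q G x0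
  for adj :: "'v \<Rightarrow> 'v \<Rightarrow> bool" and q G x0 +
  fixes \<psi> :: "('v \<Rightarrow> 'v) \<Rightarrow> real" and \<phi> :: "nat \<Rightarrow> real" and l :: real
    and H :: "'h::{real_inner, complete_space} set" and \<pi> :: "('v \<Rightarrow> 'v) \<Rightarrow> 'h \<Rightarrow> 'h"
    and b :: "('v \<Rightarrow> 'v) \<Rightarrow> 'h"
  assumes GNS: "GNS_triple grp grp_top \<psi> H \<pi> b"
    and radial: "g \<in> G \<Longrightarrow> \<psi> g = \<phi> (len g)"
    and eig: "radial_avg \<phi> n = l * \<phi> n + \<phi> 1"
    and \<phi>0: "\<phi> 0 = 0" and \<phi>1: "0 < \<phi> 1" and l1: "l \<noteq> 1"
begin

lemma H_subspace: "subspace H" and H_closed: "closed H"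
  using GNS unfolding GNS_triple_def unitary_rep_def by blast+

lemma \<pi>_H: "g \<in> G \<Longrightarrow> v \<in> H \<Longrightarrow> \<pi> g v \<in> H"
proof -
  have "\<forall>g\<in>carrier grp. \<pi> g ` H = H" using GNS unfolding GNS_triple_def unitary_rep_def by blast
  then show "g \<in> G \<Longrightarrow> v \<in> H \<Longrightarrow> \<pi> g v \<in> H" by auto
qed

lemma \<pi>_add: "g \<in> G \<Longrightarrow> v \<in> H \<Longrightarrow> w \<in> H \<Longrightarrow> \<pi> g (v + w) = \<pi> g v + \<pi> g w"
  and \<pi>_scaleR: "g \<in> G \<Longrightarrow> v \<in> H \<Longrightarrow> \<pi> g (c *\<^sub>R v) = c *\<^sub>R \<pi> g v"
  and \<pi>_inner: "g \<in> G \<Longrightarrow> v \<in> H \<Longrightarrow> w \<in> H \<Longrightarrow> \<pi> g v \<bullet> \<pi> g w = v \<bullet> w"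
  using GNS unfolding GNS_triple_def unitary_rep_def by simp_all

lemma \<pi>_id: "v \<in> H \<Longrightarrow> \<pi> id v = v"
  and \<pi>_comp: "g \<in> G \<Longrightarrow> h \<in> G \<Longrightarrow> v \<in> H \<Longrightarrow> \<pi> (g \<circ> h) v = \<pi> g (\<pi> h v)"
  using GNS unfolding GNS_triple_def unitary_rep_def by simp_all

lemma b_H: "g \<in> G \<Longrightarrow> b g \<in> H"
  and b_comp: "g \<in> G \<Longrightarrow> h \<in> G \<Longrightarrow> b (g \<circ> h) = \<pi> g (b h) + b g"
  using GNS unfolding GNS_triple_def cocycle_def by auto

lemma H_closure: "closure (span (b ` G)) = H"
  and \<psi>_norm: "g \<in> G \<Longrightarrow> \<psi> g = (norm (b g))\<^sup>2"
  using GNS unfolding GNS_triple_def by auto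

lemma \<pi>_zero: "g \<in> G \<Longrightarrow> \<pi> g 0 = 0"
  using \<pi>_scaleR[of g 0 0] subspace_0[OF H_subspace] by simp

lemma \<pi>_diff: "g \<in> G \<Longrightarrow> v \<in> H \<Longrightarrow> w \<in> H \<Longrightarrow> \<pi> g (v - w) = \<pi> g v - \<pi> g w"
  using \<pi>_add[of g "v - w" w] subspace_diff[OF H_subspace, of v w] by simp

lemma \<pi>_norm: "g \<in> G \<Longrightarrow> v \<in> H \<Longrightarrow> norm (\<pi> g v) = norm v"
  using \<pi>_inner[of g v v] by (simp add: norm_eq_sqrt_inner)

lemma \<pi>_finv: "g \<in> G \<Longrightarrow> v \<in> H \<Longrightarrow> \<pi> g (\<pi> (finv g) v) = v"
proof -
  assume g: "g \<in> G" "v \<in> H"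
  have "g \<circ> finv g = id" using g by auto
  then show ?thesis using \<pi>_comp[OF g(1) G_inv[OF g(1)] g(2)] \<pi>_id[OF g(2)] by simp
qed

lemma \<pi>_sum: "g \<in> G \<Longrightarrow> (\<And>y. f y \<in> H) \<Longrightarrow> \<pi> g (\<Sum>y\<in>A. f y) = (\<Sum>y\<in>A. \<pi> g (f y))"
  by (induction A rule: infinite_finite_induct)
     (simp_all add: \<pi>_zero \<pi>_add subspace_sum[OF H_subspace])

lemma nbr_avg_H: "(\<And>y. f y \<in> H) \<Longrightarrow> nbr_avg f x \<in> H"
  unfolding nbr_avg_def by (intro subspace_scale[OF H_subspace] subspace_sum[OF H_subspace])

lemma \<pi>_nbr_avg: "g \<in> G \<Longrightarrow> (\<And>y. f y \<in> H) \<Longrightarrow> \<pi> g (nbr_avg f x) = nbr_avg (\<lambda>y. \<pi> g (f y)) x"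
  unfolding nbr_avg_def by (simp add: \<pi>_scaleR \<pi>_sum subspace_sum[OF H_subspace])

lemma nbr_avg_translate: "g \<in> G \<Longrightarrow> nbr_avg f (g x) = nbr_avg (\<lambda>y. f (g y)) x"
  unfolding nbr_avg_def using sum.reindex_bij_betw[OF G_nbrs[of g x], of f] by simp

lemma orthogonal_to_cocycle_zero:
  assumes "v \<in> H" "\<And>g. g \<in> G \<Longrightarrow> v \<bullet> b g = 0" shows "v = 0"
proof -
  have "span (b ` G) \<subseteq> {w. v \<bullet> w = 0}"
    by (rule span_minimal) (use assms(2) in \<open>auto simp: subspace_def inner_add_right\<close>)
  moreover have "closed {w. v \<bullet> w = 0}" by (intro closed_Collect_eq continuous_intros)
  ultimately have "H \<subseteq> {w. v \<bullet> w = 0}" unfolding H_closure[symmetric] by (rule closure_minimal)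
  then show ?thesis using assms(1) by auto
qed

text \<open>The orbit of 0 under the affine action \<open>v \<mapsto> \<pi> g v + b g\<close>. The stabiliser of \<open>x0\<close>
  fixes 0, so the orbit is parametrised by vertices.\<close>

definition orbit_map :: "'v \<Rightarrow> 'h" where
  "orbit_map x = b (SOME g. g \<in> G \<and> g x0 = x)"

lemma b_stabiliser: "k \<in> G \<Longrightarrow> k x0 = x0 \<Longrightarrow> b k = 0"
  using \<psi>_norm[of k] radial[of k] \<phi>0 by simp

lemma orbit_map: "g \<in> G \<Longrightarrow> orbit_map (g x0) = b g"
proof -
  assume g: "g \<in> G"
  define h where "h = (SOME h. h \<in> G \<and> h x0 = g x0)"
  have "\<exists>h. h \<in> G \<and> h x0 = g x0" using g by blast
  from someI_ex[OF this] have h: "h \<in> G" "h x0 = g x0" unfolding h_def by auto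
  have k: "finv h \<circ> g \<in> G" "(finv h \<circ> g) x0 = x0"
    using g h G_comp G_inv inv_apply[OF h(1), of x0] by auto
  have "h \<circ> (finv h \<circ> g) = g" using h(1) by auto
  then have "b g = b h" using b_comp[OF h(1) k(1)] b_stabiliser[OF k] \<pi>_zero[OF h(1)] by simp
  then show ?thesis by (simp add: orbit_map_def h_def)
qed

lemma orbit_map_H: "orbit_map x \<in> H"
  using vertex_trans_obtain[of x0 x] orbit_map b_H by metis

lemma orbit_map_x0: "orbit_map x0 = 0"
  using orbit_map[OF G_id] b_stabiliser[OF G_id] by simp

lemma orbit_map_translate: "g \<in> G \<Longrightarrow> orbit_map (g x) = \<pi> g (orbit_map x) + b g"
proof -
  assume g: "g \<in> G"
  obtain h where h: "h \<in> G" "h x0 = x" using vertex_trans_obtain by blast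
  show ?thesis using orbit_map[OF G_comp[OF g h(1)]] orbit_map[OF h(1)] b_comp[OF g h(1)] h(2) by simp
qed

lemma orbit_map_dist: "(norm (orbit_map x - orbit_map y))\<^sup>2 = \<phi> (d x y)"
proof -
  obtain g h where g: "g \<in> G" "g x0 = x" and h: "h \<in> G" "h x0 = y" using vertex_trans_obtain by metis
  have gh: "finv g \<circ> h \<in> G" using g h G_comp G_inv by blast
  have "g \<circ> (finv g \<circ> h) = h" using g by auto
  then have "orbit_map y - orbit_map x = \<pi> g (b (finv g \<circ> h))"
    using b_comp[OF g(1) gh] orbit_map[OF g(1)] orbit_map[OF h(1)] g h by simp
  then have "norm (orbit_map x - orbit_map y) = norm (b (finv g \<circ> h))"
    using \<pi>_norm[OF g(1) b_H[OF gh]] by (metis norm_minus_commute)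
  then show ?thesis using \<psi>_norm[OF gh] radial[OF gh] len_diff[OF g(1) h(1)] g h by simp
qed

lemma orbit_map_inner: "orbit_map x \<bullet> orbit_map y = (\<phi> (d x0 x) + \<phi> (d x0 y) - \<phi> (d y x)) / 2"
proof -
  have n: "(norm (orbit_map z))\<^sup>2 = \<phi> (d x0 z)" for z
    using orbit_map_dist[of x0 z] by (simp add: orbit_map_x0)
  have "orbit_map x \<bullet> orbit_map y
      = ((norm (orbit_map x))\<^sup>2 + (norm (orbit_map y))\<^sup>2 - (norm (orbit_map x - orbit_map y))\<^sup>2) / 2"
    by (rule dot_norm_neg)
  then show ?thesis by (simp only: n orbit_map_dist dist_sym[of y x])
qed

definition laplacian :: "'v \<Rightarrow> 'h" where
  "laplacian x = nbr_avg orbit_map x - orbit_map x"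

abbreviation \<delta> :: 'h where "\<delta> \<equiv> laplacian x0"

lemma laplacian_H: "laplacian x \<in> H"
  unfolding laplacian_def by (intro subspace_diff[OF H_subspace] nbr_avg_H orbit_map_H)

lemma laplacian_translate: "g \<in> G \<Longrightarrow> laplacian (g x) = \<pi> g (laplacian x)"
  unfolding laplacian_def
  by (simp add: nbr_avg_translate orbit_map_translate nbr_avg_add nbr_avg_const
      \<pi>_diff \<pi>_nbr_avg orbit_map_H nbr_avg_H)

text \<open>The inner products of both sides with the orbit are expressed by \<open>\<phi>\<close> and agree by
  the eigenvalue equation; the orbit spans a dense subspace.\<close>

lemma nbr_avg_orbit_map: "nbr_avg orbit_map x = l *\<^sub>R orbit_map x + \<delta>"
proof -
  define v where "v = nbr_avg orbit_map x - l *\<^sub>R orbit_map x - \<delta>"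
  have avg: "nbr_avg orbit_map x \<bullet> orbit_map y
      = (radial_avg \<phi> (d x0 x) + \<phi> (d x0 y) - radial_avg \<phi> (d y x)) / 2" for x y
  proof -
    have "nbr_avg orbit_map x \<bullet> orbit_map y
      = nbr_avg (\<lambda>z. (1 / 2) *\<^sub>R (\<phi> (d x0 z) + \<phi> (d x0 y) - \<phi> (d y z))) x"
      by (simp add: nbr_avg_inner orbit_map_inner)
    then show ?thesis
      unfolding nbr_avg_scaleR nbr_avg_diff nbr_avg_add nbr_avg_const nbr_avg_radial by simp
  qed
  have "v \<bullet> b g = 0" if "g \<in> G" for g
  proof -
    have "v \<bullet> orbit_map y = 0" for y
    proof -
      have "v \<bullet> orbit_map y = nbr_avg orbit_map x \<bullet> orbit_map y - l * (orbit_map x \<bullet> orbit_map y)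
          - nbr_avg orbit_map x0 \<bullet> orbit_map y"
        by (simp only: v_def laplacian_def orbit_map_x0 inner_diff_left inner_scaleR_left diff_zero)
      then show ?thesis
        unfolding avg orbit_map_inner eig dist_sym[of y x0] by (simp add: \<phi>0 field_simps)
    qed
    then show ?thesis using orbit_map[OF that] by metis
  qed
  moreover have "v \<in> H"
    unfolding v_def
    by (intro subspace_diff[OF H_subspace] subspace_scale[OF H_subspace] nbr_avg_H orbit_map_H laplacian_H)
  ultimately have "v = 0" by (rule orthogonal_to_cocycle_zero[rotated])
  then show ?thesis by (simp add: v_def algebra_simps)
qed

lemma laplacian_eq: "laplacian x = (l - 1) *\<^sub>R orbit_map x + \<delta>"
  using nbr_avg_orbit_map[of x] by (simp add: laplacian_def algebra_simps)

lemma nbr_avg_laplacian: "nbr_avg laplacian x = l *\<^sub>R laplacian x"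
proof -
  have "nbr_avg laplacian x = nbr_avg (\<lambda>x. (l - 1) *\<^sub>R orbit_map x + \<delta>) x"
    by (rule arg_cong[of _ _ "\<lambda>f. nbr_avg f x"], rule ext, rule laplacian_eq)
  also have "\<dots> = (l - 1) *\<^sub>R (l *\<^sub>R orbit_map x + \<delta>) + \<delta>"
    unfolding nbr_avg_add nbr_avg_scaleR nbr_avg_const nbr_avg_orbit_map ..
  also have "\<dots> = l *\<^sub>R ((l - 1) *\<^sub>R orbit_map x + \<delta>)" by (simp add: algebra_simps)
  finally show ?thesis by (simp only: laplacian_eq[of x, symmetric])
qed

lemma cocycle_coboundary: "g \<in> G \<Longrightarrow> (l - 1) *\<^sub>R b g = \<pi> g \<delta> - \<delta>"
  using laplacian_eq[of "g x0"] laplacian_translate[of g x0] orbit_map[of g] by (simp add: algebra_simps)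

lemma \<delta>_fixed: "k \<in> G \<Longrightarrow> k x0 = x0 \<Longrightarrow> \<pi> k \<delta> = \<delta>"
  using laplacian_translate[of k x0] by simp

lemma \<delta>_nonzero: "\<delta> \<noteq> 0"
proof
  assume \<delta>: "\<delta> = 0"
  obtain g where g: "g \<in> G" "len g = 1" using len_surj by blast
  have "b g = 0" using cocycle_coboundary[OF g(1)] l1 \<delta> \<pi>_zero[OF g(1)] by simp
  then show False using \<psi>_norm[OF g(1)] radial[OF g(1)] g \<phi>1 by simp
qed

text \<open>The coefficient \<open>\<eta> \<bullet> laplacian x\<close> is invariant under the stabiliser of \<open>x0\<close>, hence
  radial, and it is an eigenfunction of the average with value 0 at \<open>x0\<close>.\<close>

lemma fixed_orthogonal_zero:
  assumes \<eta>: "\<eta> \<in> H" "\<And>k. k \<in> G \<Longrightarrow> k x0 = x0 \<Longrightarrow> \<pi> k \<eta> = \<eta>" and orth: "\<eta> \<bullet> \<delta> = 0"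
  shows "\<eta> = 0"
proof -
  define f where "f x = \<eta> \<bullet> laplacian x" for x
  have inv: "f x = f y" if "d x0 x = d x0 y" for x y
  proof -
    obtain k where k: "k \<in> G" "k x0 = x0" "k x = y" using sphere_transitive[OF \<open>d x0 x = d x0 y\<close>] by blast
    have "f y = \<pi> k \<eta> \<bullet> \<pi> k (laplacian x)"
      using k \<eta>(2)[OF k(1,2)] laplacian_translate[OF k(1), of x] by (simp add: f_def)
    then show ?thesis using \<pi>_inner[OF k(1) \<eta>(1) laplacian_H] by (simp add: f_def)
  qed
  define F where "F n = f (SOME x. d x0 x = n)" for n
  have F: "f x = F (d x0 x)" for x
    unfolding F_def by (rule inv) (metis (mono_tags, lifting) someI)
  have "radial_avg F n = l * F n" for n
  proof -
    obtain x where x: "d x0 x = n" using vertex_at_distance by blast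
    have "radial_avg F n = nbr_avg (\<lambda>z. F (d x0 z)) x" using nbr_avg_radial x by simp
    also have "\<dots> = nbr_avg (\<lambda>z. laplacian z \<bullet> \<eta>) x"
      unfolding F[symmetric] f_def by (simp add: inner_commute)
    also have "\<dots> = nbr_avg laplacian x \<bullet> \<eta>" by (simp add: nbr_avg_inner)
    also have "\<dots> = l * F n" using x F[of x] by (simp add: nbr_avg_laplacian f_def inner_commute)
    finally show ?thesis .
  qed
  moreover have "F 0 = 0" using F[of x0] orth by (simp add: f_def)
  ultimately have "F n = 0" for n by (rule radial_eigenfunction_zero)
  then have z: "\<eta> \<bullet> laplacian x = 0" for x using F[of x] by (simp add: f_def)
  have "\<eta> \<bullet> b g = 0" if g: "g \<in> G" for g
  proof -
    have "(l - 1) * (\<eta> \<bullet> b g) = \<eta> \<bullet> (\<pi> g \<delta> - \<delta>)"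
      using cocycle_coboundary[OF g] by (metis inner_scaleR_right)
    also have "\<dots> = 0" using z[of "g x0"] z[of x0] laplacian_translate[OF g, of x0] by (simp add: inner_diff_right)
    finally show ?thesis using l1 by simp
  qed
  then show ?thesis using \<eta>(1) by (rule orthogonal_to_cocycle_zero[rotated])
qed

lemma fixed_multiple:
  assumes \<eta>: "\<eta> \<in> H" "\<And>k. k \<in> G \<Longrightarrow> k x0 = x0 \<Longrightarrow> \<pi> k \<eta> = \<eta>"
  shows "\<exists>c. \<eta> = c *\<^sub>R \<delta>"
proof -
  define c where "c = (\<eta> \<bullet> \<delta>) / (\<delta> \<bullet> \<delta>)"
  have "\<eta> - c *\<^sub>R \<delta> = 0"
  proof (rule fixed_orthogonal_zero)
    show "\<eta> - c *\<^sub>R \<delta> \<in> H"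
      by (intro subspace_diff[OF H_subspace] subspace_scale[OF H_subspace] \<eta>(1) laplacian_H)
    show "\<pi> k (\<eta> - c *\<^sub>R \<delta>) = \<eta> - c *\<^sub>R \<delta>" if "k \<in> G" "k x0 = x0" for k
      using that \<eta> \<delta>_fixed[OF that] laplacian_H
      by (simp add: \<pi>_diff \<pi>_scaleR subspace_scale[OF H_subspace])
    show "(\<eta> - c *\<^sub>R \<delta>) \<bullet> \<delta> = 0" using \<delta>_nonzero by (simp add: c_def inner_diff_left)
  qed
  then show ?thesis by auto
qed

text \<open>The projection \<open>p\<close> of \<open>\<delta>\<close> to an invariant subspace \<open>W\<close> is fixed by the stabiliser
  of \<open>x0\<close>, hence a multiple of \<open>\<delta>\<close>. If \<open>p = 0\<close>, all translates of \<open>\<delta>\<close> are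
  orthogonal to \<open>W\<close>; otherwise all of them lie in \<open>W\<close>. The translates determine the cocycle,
  which generates the space.\<close>

lemma irreducible: "irreducible_rep grp H \<pi>"
  unfolding irreducible_rep_def
proof (intro conjI allI impI)
  show "H \<noteq> {0}" using laplacian_H \<delta>_nonzero by blast
next
  fix W assume W: "subspace W" "closed W" "W \<subseteq> H" "\<forall>g\<in>carrier grp. \<pi> g ` W \<subseteq> W"
  have W_inv: "\<pi> g w \<in> W" if "g \<in> G" "w \<in> W" for g w using W(4) that by auto
  obtain p where p: "p \<in> W" "\<And>w. w \<in> W \<Longrightarrow> (\<delta> - p) \<bullet> w = 0"
    using orthogonal_projection_exists[OF W(1,2)] by blast
  have "\<pi> k p = p" if k: "k \<in> G" "k x0 = x0" for k
  proof -
    define e where "e = \<pi> k p - p"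
    have eW: "e \<in> W" unfolding e_def using W(1) W_inv k p by (intro subspace_diff) auto
    have eW': "\<pi> (finv k) e \<in> W" using W_inv G_inv[OF k(1)] eW by blast
    have "(\<delta> - \<pi> k p) \<bullet> e = \<pi> k (\<delta> - p) \<bullet> \<pi> k (\<pi> (finv k) e)"
      using \<pi>_diff[OF k(1) laplacian_H] \<delta>_fixed[OF k] \<pi>_finv[OF k(1)] eW p(1) W(3) by (metis subsetD)
    also have "\<dots> = (\<delta> - p) \<bullet> \<pi> (finv k) e"
      using \<pi>_inner[OF k(1)] subspace_diff[OF H_subspace laplacian_H] p(1) eW' W(3) by blast
    also have "\<dots> = 0" using p(2)[OF eW'] .
    finally have "(\<delta> - \<pi> k p) \<bullet> e = 0" .
    then have "e \<bullet> e = 0" using p(2)[OF eW] by (simp add: e_def inner_diff_left)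
    then show ?thesis by (simp add: e_def)
  qed
  then obtain c where c: "p = c *\<^sub>R \<delta>" using fixed_multiple p(1) W(3) by blast
  show "W = {0} \<or> W = H"
  proof (cases "c = 0")
    case True
    have "w = 0" if w: "w \<in> W" for w
    proof (rule orthogonal_to_cocycle_zero)
      show "w \<in> H" using w W(3) by blast
      fix g assume g: "g \<in> G"
      have orth: "\<delta> \<bullet> w' = 0" if "w' \<in> W" for w' using p(2)[OF that] c True by simp
      have "\<pi> g \<delta> \<bullet> w = \<pi> g \<delta> \<bullet> \<pi> g (\<pi> (finv g) w)" using \<pi>_finv[OF g \<open>w \<in> H\<close>] by simp
      also have "\<dots> = \<delta> \<bullet> \<pi> (finv g) w"
        using \<pi>_inner[OF g laplacian_H \<pi>_H[OF G_inv[OF g] \<open>w \<in> H\<close>]] .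
      also have "\<dots> = 0" using orth W_inv[OF G_inv[OF g] w] by blast
      finally have "(l - 1) * (w \<bullet> b g) = 0"
        using cocycle_coboundary[OF g] orth[OF w]
        by (metis inner_commute inner_diff_right inner_scaleR_right diff_self)
      then show "w \<bullet> b g = 0" using l1 by simp
    qed
    then have "W = {0}" using subspace_0[OF W(1)] by blast
    then show ?thesis ..
  next
    case False
    then have "\<delta> = (1 / c) *\<^sub>R p" using c by simp
    then have \<delta>W: "\<delta> \<in> W" using subspace_scale[OF W(1) p(1)] by simp
    have "b g \<in> W" if g: "g \<in> G" for g
    proof -
      have "b g = (1 / (l - 1)) *\<^sub>R (\<pi> g \<delta> - \<delta>)" using cocycle_coboundary[OF g, symmetric] l1 by simp
      then show ?thesis using W_inv[OF g \<delta>W] \<delta>W W(1) by (simp add: subspace_diff subspace_scale)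
    qed
    then have "H \<subseteq> W"
      unfolding H_closure[symmetric] using W(1,2) by (intro closure_minimal span_minimal) auto
    then show ?thesis using W(3) by blast
  qed
qed

lemma coboundary_vector:
  "\<exists>\<xi>\<in>H. (\<forall>k\<in>vertex_stabiliser G x0. \<pi> k \<xi> = \<xi>) \<and>
      (\<forall>g\<in>G. \<psi> g = (norm \<xi>)\<^sup>2 - \<pi> g \<xi> \<bullet> \<xi>) \<and>
      (\<forall>\<eta>\<in>H. (\<forall>k\<in>vertex_stabiliser G x0. \<pi> k \<eta> = \<eta>) \<longrightarrow> (\<exists>c. \<eta> = c *\<^sub>R \<xi>))"
proof -
  \<comment> \<open>The factor \<open>sqrt 2\<close> turns \<open>\<parallel>\<pi> g v - v\<parallel>\<^sup>2 = 2 (\<parallel>v\<parallel>\<^sup>2 - \<langle>\<pi> g v, v\<rangle>)\<close> into the normalisation of the conclusion.\<close>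
  define s where "s = sqrt 2 / (l - 1)"
  have s: "s \<noteq> 0" "s * s = 2 / (l - 1)\<^sup>2" using l1 by (auto simp: s_def power2_eq_square)
  have K: "k \<in> vertex_stabiliser G x0 \<longleftrightarrow> k \<in> G \<and> k x0 = x0" for k by (simp add: vertex_stabiliser_def)
  have "\<psi> g = (norm (s *\<^sub>R \<delta>))\<^sup>2 - \<pi> g (s *\<^sub>R \<delta>) \<bullet> (s *\<^sub>R \<delta>)" if g: "g \<in> G" for g
  proof -
    have "(l - 1)\<^sup>2 * \<psi> g = (norm (\<pi> g \<delta> - \<delta>))\<^sup>2"
      using cocycle_coboundary[OF g, symmetric] \<psi>_norm[OF g] by (simp add: power_mult_distrib)
    also have "\<dots> = 2 * ((norm \<delta>)\<^sup>2 - \<pi> g \<delta> \<bullet> \<delta>)"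
      unfolding power2_norm_eq_inner using \<pi>_inner[OF g laplacian_H laplacian_H, of x0 x0]
      by (simp add: inner_diff_left inner_diff_right inner_commute)
    finally have "\<psi> g = (s * s) * ((norm \<delta>)\<^sup>2 - \<pi> g \<delta> \<bullet> \<delta>)"
      using l1 by (simp add: s(2) field_simps)
    then show ?thesis
      using g laplacian_H by (simp add: \<pi>_scaleR power_mult_distrib power2_eq_square algebra_simps)
  qed
  moreover have "\<exists>c. \<eta> = c *\<^sub>R (s *\<^sub>R \<delta>)"
    if "\<eta> \<in> H" "\<forall>k\<in>vertex_stabiliser G x0. \<pi> k \<eta> = \<eta>" for \<eta>
  proof -
    have "\<pi> k \<eta> = \<eta>" if "k \<in> G" "k x0 = x0" for k
      using \<open>\<forall>k\<in>vertex_stabiliser G x0. \<pi> k \<eta> = \<eta>\<close> that K by blast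
    from fixed_multiple[OF that(1) this] obtain c where "\<eta> = c *\<^sub>R \<delta>" by blast
    then have "\<eta> = (c / s) *\<^sub>R (s *\<^sub>R \<delta>)" using s(1) by simp
    then show ?thesis by blast
  qed
  moreover have "\<pi> k (s *\<^sub>R \<delta>) = s *\<^sub>R \<delta>" if "k \<in> vertex_stabiliser G x0" for k
    using that \<delta>_fixed[of k] laplacian_H by (simp add: K \<pi>_scaleR)
  moreover have "s *\<^sub>R \<delta> \<in> H" by (intro subspace_scale[OF H_subspace] laplacian_H)
  ultimately show ?thesis by (intro bexI[of _ "s *\<^sub>R \<delta>"]) blast+
qed

end

section \<open>Bounded and unbounded pure functions\<close>

theorem corollary5p7:
  fixes q :: nat
    and adj :: "'v \<Rightarrow> 'v \<Rightarrow> bool"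
    and G :: "('v \<Rightarrow> 'v) set"
    and \<psi> :: "('v \<Rightarrow> 'v) \<Rightarrow> real"
    and x\<^sub>0 :: 'v
  defines "\<G> \<equiv> (Aut adj)\<lparr>carrier := G\<rparr>"
    and "T \<equiv> subtopology (Aut_topology adj) G"
  assumes "q \<ge> 2"
    and "regular_tree (q + 1) adj"
    and "subgroup G (Aut adj)"
    and "closedin (Aut_topology adj) G"
    and "\<not> compactin (Aut_topology adj) G"
    and "vertex_transitive G"
    and "boundary_transitive adj G"
    and "pure_in_CL \<G> T \<psi>"
    and "\<forall>g\<in>vertex_stabiliser G x\<^sub>0. \<psi> g = 0"
  shows "(bounded (\<psi> ` G) \<and>
          (\<forall>(H :: 'h::{real_inner, complete_space} set) \<pi> b.
             GNS_triple \<G> T \<psi> H \<pi> b \<longrightarrow>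
             irreducible_rep \<G> H \<pi> \<and>
             (\<exists>\<xi>\<in>H. (\<forall>k\<in>vertex_stabiliser G x\<^sub>0. \<pi> k \<xi> = \<xi>) \<and>
                (\<forall>g\<in>G. \<psi> g = (norm \<xi>)\<^sup>2 - \<pi> g \<xi> \<bullet> \<xi>) \<and>
                (\<forall>\<eta>\<in>H. (\<forall>k\<in>vertex_stabiliser G x\<^sub>0. \<pi> k \<eta> = \<eta>) \<longrightarrow> (\<exists>c. \<eta> = c *\<^sub>R \<xi>)))))
       \<or> (\<not> bounded (\<psi> ` G) \<and>
          (\<exists>C>0. \<forall>g\<in>G.
             \<psi> g = C * (real (graph_dist adj (g x\<^sub>0) x\<^sub>0)
                        + 2 * real q / ((real q)\<^sup>2 - 1)
                          * (real q powi (- int (graph_dist adj (g x\<^sub>0) x\<^sub>0)) - 1))))"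
proof -
  interpret boundary_transitive_group adj q G x\<^sub>0
    by (intro boundary_transitive_group.intro regular_tree_graph.intro
        boundary_transitive_group_axioms.intro) fact+
  have pure: "pure_in_CL grp grp_top \<psi>"
    using \<open>pure_in_CL \<G> T \<psi>\<close> unfolding \<G>_def T_def .
  obtain \<phi> l where \<phi>: "\<forall>g\<in>G. \<psi> g = \<phi> (len g)" "\<phi> 0 = 0" "0 < \<phi> 1" "\<forall>n. 0 \<le> \<phi> n"
    "negative_kernel \<phi>" and eig: "\<And>n. radial_avg \<phi> n = l * \<phi> n + \<phi> 1"
    using pure_radial_eigenfunction[OF pure \<open>\<forall>g\<in>vertex_stabiliser G x\<^sub>0. \<psi> g = 0\<close>] by metis
  show ?thesis
  proof (cases "l = 1")
    case True
    define C where "C = (real q + 1) / (real q - 1) * \<phi> 1"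
    have C: "0 < C" using \<phi>(3) q2 by (simp add: C_def)
    have form: "\<phi> n = C * (real n + 2 * real q / ((real q)\<^sup>2 - 1) * (real q powi (- int n) - 1))" for n
      unfolding C_def by (rule harmonic_kernel_formula) (use eig True \<phi>(2) in auto)
    have unbounded: "\<not> bounded (\<psi> ` G)"
    proof
      assume "bounded (\<psi> ` G)"
      then obtain B where "\<forall>x\<in>\<psi> ` G. norm x \<le> B" unfolding bounded_iff by blast
      then have B: "\<phi> n \<le> B" for n using len_surj[of n] \<phi>(1) by force
      \<comment> \<open>As \<open>q powi (- n) \<ge> 0\<close>, the function grows at least like \<open>C * (n - e)\<close>.\<close>
      define e where "e = 2 * real q / ((real q)\<^sup>2 - 1)"
      have "1 < (real q)\<^sup>2" using q2 by (simp add: one_less_power)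
      then have e: "0 \<le> e" by (simp add: e_def)
      obtain n where n: "B / C + e < real n" using reals_Archimedean2 by blast
      have "- e \<le> e * (real q powi (- int n) - 1)"
        using mult_left_mono[of "- 1" "real q powi (- int n) - 1" e] e by simp
      then have "C * (real n - e) \<le> \<phi> n"
        unfolding form e_def[symmetric] using C by (intro mult_left_mono) auto
      moreover have "B < C * (real n - e)" using n C by (simp add: field_simps)
      ultimately show False using B[of n] by simp
    qed
    show ?thesis
    proof (intro disjI2 conjI exI[of _ C] ballI)
      fix g assume "g \<in> G"
      then have "\<psi> g = \<phi> (len g)" using \<phi>(1) by blast
      then show "\<psi> g = C * (real (len g) + 2 * real q / ((real q)\<^sup>2 - 1) * (real q powi (- int (len g)) - 1))"
        by (simp only: form)
    qed (fact unbounded C)+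
  next
    case False
    have "bounded (\<psi> ` G)"
      unfolding bounded_iff
    proof (intro exI ballI)
      fix y assume "y \<in> \<psi> ` G"
      then obtain g where "g \<in> G" "y = \<phi> (len g)" using \<phi>(1) by auto
      then show "norm y \<le> 2 * (1 - l) * \<phi> 1 / (l - 1)\<^sup>2"
        using eigen_kernel_bounded[OF \<phi>(5) eig \<phi>(2), of "len g"] \<phi>(4) False
        by (simp add: pos_le_divide_eq mult.commute)
    qed
    moreover have "irreducible_rep \<G> H \<pi> \<and>
             (\<exists>\<xi>\<in>H. (\<forall>k\<in>vertex_stabiliser G x\<^sub>0. \<pi> k \<xi> = \<xi>) \<and>
                (\<forall>g\<in>G. \<psi> g = (norm \<xi>)\<^sup>2 - \<pi> g \<xi> \<bullet> \<xi>) \<and>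
                (\<forall>\<eta>\<in>H. (\<forall>k\<in>vertex_stabiliser G x\<^sub>0. \<pi> k \<eta> = \<eta>) \<longrightarrow> (\<exists>c. \<eta> = c *\<^sub>R \<xi>)))"
      if "GNS_triple \<G> T \<psi> H \<pi> b" for H :: "'h set" and \<pi> b
    proof -
      interpret nonharmonic_GNS adj q G x\<^sub>0 \<psi> \<phi> l H \<pi> b
        by unfold_locales (use that \<phi> eig False in \<open>auto simp: \<G>_def T_def\<close>)
      show ?thesis using irreducible coboundary_vector unfolding \<G>_def by blast
    qed
    ultimately show ?thesis by blast
  qed
qed

end
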